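(* Let $0<\lambda<1$, $\mathcal{B}=\{0=b_1<b_2<\dots<b_N=1-\lambda\}$, $\tau_{b_i}(x)=\lambda x+b_i$ on $\mathbb{R}$, weights $p_1,\dots,p_N>0$ summing to $1$, $X$ the attractor and $\mu=\sum_{i=1}^Np_i\mu\circ\tau_{b_i}^{-1}$ the self-similar measure. Suppose $\mu$ is absolutely continuous with respect to Lebesgue measure on $X$ and $\mu$ admits a tight frame measure. Then (i) $p_1=\dots=p_N=\lambda$; (ii) $\lambda=\frac1N$; (iii) there exists $\alpha>0$ such that $\mathcal{D}:=\alpha\mathcal{B}\subset\mathbb{Z}$ and $\mathcal{D}$ tiles $\mathbb{Z}$, i.e. there is $\mathcal{E}\subset\mathbb{Z}$ with $\mathcal{D}\oplus\mathcal{E}=\mathbb{Z}$.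
   Context: The attractor $X$ is the unique nonempty compact set with $X=\bigcup_i\tau_{b_i}(X)$. A Borel measure $\nu$ is a tight frame measure for $\mu$ if there is $A>0$ with $\|\widehat{f\,d\mu}\|_{L^2(\nu)}^2=A\|f\|_{L^2(\mu)}^2$ for all $f\in L^2(\mu)$, where $\widehat{f\,d\mu}(t)=\int f(x)e^{-2\pi itx}d\mu(x)$. $\mathcal{D}\oplus\mathcal{E}=\mathbb{Z}$ means every integer is uniquely $d+e$ with $d\in\mathcal{D}$, $e\in\mathcal{E}$. *)

theory Defs
  imports "HOL-Probability.Probability"
begin

definition tau :: "real \<Rightarrow> real \<Rightarrow> real \<Rightarrow> real" where
  "tau lam b x = lam * x + b"

definition is_attractor :: "real \<Rightarrow> (nat \<Rightarrow> real) \<Rightarrow> nat \<Rightarrow> real set \<Rightarrow> bool" where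
  "is_attractor lam b N X \<longleftrightarrow>
     X \<noteq> {} \<and> compact X \<and> X = (\<Union>i\<in>{1..N}. tau lam (b i) ` X) \<and>
     (\<forall>Y. Y \<noteq> {} \<and> compact Y \<and> Y = (\<Union>i\<in>{1..N}. tau lam (b i) ` Y) \<longrightarrow> Y = X)"

definition is_self_similar_measure ::
  "real \<Rightarrow> (nat \<Rightarrow> real) \<Rightarrow> (nat \<Rightarrow> real) \<Rightarrow> nat \<Rightarrow> real measure \<Rightarrow> bool" where
  "is_self_similar_measure lam b p N \<mu> \<longleftrightarrow>
     prob_space \<mu> \<and> sets \<mu> = sets borel \<and>
     (\<forall>A\<in>sets borel. emeasure \<mu> A =
        (\<Sum>i\<in>{1..N}. ennreal (p i) * emeasure \<mu> (tau lam (b i) -` A)))"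

definition fourier_meas :: "real measure \<Rightarrow> (real \<Rightarrow> complex) \<Rightarrow> real \<Rightarrow> complex" where
  "fourier_meas \<mu> f t = (\<integral>x. f x * exp (- (2 * pi * \<i> * complex_of_real (t * x))) \<partial>\<mu>)"

definition in_L2 :: "real measure \<Rightarrow> (real \<Rightarrow> complex) \<Rightarrow> bool" where
  "in_L2 \<mu> f \<longleftrightarrow> f \<in> borel_measurable \<mu> \<and> integrable \<mu> (\<lambda>x. (cmod (f x))\<^sup>2)"

definition tight_frame_measure :: "real measure \<Rightarrow> real measure \<Rightarrow> bool" where
  "tight_frame_measure \<mu> \<nu> \<longleftrightarrow> sets \<nu> = sets borel \<and>
     (\<exists>A::real. A > 0 \<and> (\<forall>f. in_L2 \<mu> f \<longrightarrow>
        (\<integral>\<^sup>+ t. ennreal ((cmod (fourier_meas \<mu> f t))\<^sup>2) \<partial>\<nu>)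
          = ennreal A * (\<integral>\<^sup>+ x. ennreal ((cmod (f x))\<^sup>2) \<partial>\<mu>)))"

definition direct_sum_Z :: "int set \<Rightarrow> int set \<Rightarrow> bool" where
  "direct_sum_Z D E \<longleftrightarrow> (\<forall>z::int. \<exists>!de. fst de \<in> D \<and> snd de \<in> E \<and> z = fst de + snd de)"

end

theory Submission
  imports Defs
begin

text \<open>Testing the frame identity on modulated indicator functions and exchanging the order of
  integration against Lebesgue measure shows that Lebesgue measure is a tight frame measure too;
  comparing Gaussian averages of both sides then forces the density of the self-similar measure to be
  a constant multiple of the indicator of some set $S$. The self-similarity becomes
  $1_S = \sum_i (p_i/\lambda) 1_{\tau_i S}$, and reading this from left to right, each new piece
  starts at a place which the later ones do not reach, so that every weight $p_i/\lambda$ is $1$.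

  Hence $N X = X + D$ with $D = N B$ is a measure-disjoint union of $N$ copies of $X$. Such a set has
  interior, so blowing it up gives a tiling of the line by translates of $X$. These tilings have
  finite local complexity, from which every additive function on the reals is proportional to the
  identity on $D$; thus $D$ is commensurable. Restricting a tiling to a generic coset of
  the integers gives the integer tiling.\<close>

section \<open>Self-affine tiles\<close>

text \<open>By Plancherel the Lebesgue energy of \<open>1_A d\<mu>\<close> would be the integral of
  \<open>g\<^sup>2\<close> over \<open>A\<close>, where \<open>g\<close> is the density of
  \<open>\<mu>\<close>; the frame identity makes it the constant \<open>energy UNIV\<close> times
  the integral of \<open>g\<close> over \<open>A\<close>. As \<open>A\<close> is arbitrary,
  \<open>g\<close> can only be 0 or this constant. But neither the energy nor the
  \<open>L\<^sup>2\<close> norm of \<open>g\<close> is known to be finite beforehand, so Plancherel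
  is replaced by two inequalities, obtained by Gaussian damping, on sets where \<open>g\<close> is
  bounded or nearly constant. The frame measure is an arbitrary Borel measure, and the
  sigma-finiteness that the exchange of integrals requires has to be extracted from the frame
  identity as well.

  In the geometric half all disjointness goes back to one count: \<open>N ^ n\<close> times
  \<open>X\<close> has \<open>N ^ n\<close> times the measure of \<open>X\<close> and consists of at
  most \<open>N ^ n\<close> tiles. This controls pairs of tiles whose offset is a difference of
  digit sums of equal length, so a tiling is required to have all its offsets of this form. The same
  comparison of measures bounds how many such tiles can meet a bounded interval.\<close>

locale self_affine_tile =
  fixes N :: nat and D X :: "real set"
  assumes N_ge_2: "2 \<le> N" and card_D: "card D = N" and zero_in_D: "0 \<in> D"
    and compact_X: "compact X" and X_subset: "X \<subseteq> {0..1}"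
    and zero_in_X: "0 \<in> X" and one_in_X: "1 \<in> X"
    and measure_X_pos: "0 < measure lebesgue X"
    and expand: "(*) (real N) ` X = (\<Union>d\<in>D. (+) d ` X)"
begin

abbreviation tile :: "real \<Rightarrow> real set" where
  "tile t \<equiv> (+) t ` X"

text \<open>The base-\<open>N\<close> expansions of length \<open>n\<close> with digits in
  \<open>D\<close>: the offsets of the tiles that make up \<open>X\<close> magnified by
  \<open>N ^ n\<close> (\<open>expand_power\<close>). The recursion adds the least significant
  digit.\<close>

primrec digit_sums :: "nat \<Rightarrow> real set" where
  "digit_sums 0 = {0}"
| "digit_sums (Suc n) = (\<lambda>(d, t). d + real N * t) ` (D \<times> digit_sums n)"

text \<open>The admissible offsets between two tiles of one tiling: by
  \<open>negligible_tile_Int\<close>, distinct tiles at such an offset overlap in a null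
  set.\<close>

definition differences :: "real set" where
  "differences = (\<Union>n. {s - t |s t. s \<in> digit_sums n \<and> t \<in> digit_sums n})"

lemma finite_D: "finite D"
  using card_D N_ge_2 by (metis card.infinite not_numeral_le_zero)

lemma tile_iff: "x \<in> tile t \<longleftrightarrow> x - t \<in> X"
proof
  assume "x - t \<in> X"
  then have "t + (x - t) \<in> tile t" by blast
  then show "x \<in> tile t" by simp
qed auto

lemma tile_subset: "tile t \<subseteq> {t..t+1}"
  using X_subset by auto

lemma expand_iff: "x / real N \<in> X \<longleftrightarrow> (\<exists>d\<in>D. x - d \<in> X)"
proof -
  have "x / real N \<in> X \<longleftrightarrow> x \<in> (*) (real N) ` X"
    using N_ge_2 by (auto simp: image_iff intro!: bexI[of _ "x / real N"])
  then show ?thesis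
    unfolding expand using tile_iff by auto
qed

lemma D_bounds: assumes "d \<in> D" shows "0 \<le> d" "d \<le> real N - 1"
proof -
  have "d / real N \<in> X" "(d + 1) / real N \<in> X"
    using expand_iff assms zero_in_X one_in_X by force+
  then show "0 \<le> d" "d \<le> real N - 1"
    using X_subset N_ge_2 by (auto simp: field_simps)
qed

lemma compact_tile: "compact (tile t)"
  using compact_X by (rule compact_translation)

lemma lmeasurable_X: "X \<in> lmeasurable"
  using compact_X by (rule lmeasurable_compact)

lemma lmeasurable_tile: "tile t \<in> lmeasurable"
  using compact_tile by (rule lmeasurable_compact)

lemma measure_tile: "measure lebesgue (tile t) = measure lebesgue X"
  by (rule measure_translation)

lemma finite_digit_sums: "finite (digit_sums n)"
  by (induction n) (auto simp: finite_D)

lemma card_digit_sums_le: "card (digit_sums n) \<le> N ^ n"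
proof (induction n)
  case (Suc n)
  have "card (digit_sums (Suc n)) \<le> card (D \<times> digit_sums n)"
    unfolding digit_sums.simps using finite_D finite_digit_sums by (intro card_image_le finite_cartesian_product)
  also have "\<dots> \<le> N * N ^ n"
    using Suc by (simp add: card_cartesian_product card_D)
  finally show ?case by simp
qed simp

lemma zero_in_digit_sums: "0 \<in> digit_sums n"
  by (induction n) (use zero_in_D in force)+

lemma digit_sums_bounds: "t \<in> digit_sums n \<Longrightarrow> 0 \<le> t \<and> t \<le> real N ^ n - 1"
proof (induction n arbitrary: t)
  case (Suc n)
  then obtain d s where *: "d \<in> D" "s \<in> digit_sums n" "t = d + real N * s" by auto
  have "0 \<le> s" "s \<le> real N ^ n - 1" using Suc.IH *(2) by auto
  moreover have "real N * s \<le> real N * (real N ^ n - 1)"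
    using calculation by (intro mult_left_mono) auto
  ultimately show ?case
    using D_bounds[OF *(1)] *(3) by (auto simp: algebra_simps)
qed simp

lemma expand_power_iff: "x / real N ^ n \<in> X \<longleftrightarrow> (\<exists>t\<in>digit_sums n. x \<in> tile t)"
proof (induction n arbitrary: x)
  case 0
  then show ?case by (simp add: tile_iff)
next
  case (Suc n)
  have "x / real N ^ Suc n \<in> X \<longleftrightarrow> (\<exists>t\<in>digit_sums n. (x / real N) - t \<in> X)"
    using Suc.IH[of "x / real N"] by (simp add: tile_iff)
  also have "\<dots> \<longleftrightarrow> (\<exists>t\<in>digit_sums n. \<exists>d\<in>D. x - real N * t - d \<in> X)"
  proof -
    have "(x / real N) - t = (x - real N * t) / real N" for t
      using N_ge_2 by (simp add: field_simps)
    then show ?thesis using expand_iff by simp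
  qed
  also have "\<dots> \<longleftrightarrow> (\<exists>t\<in>digit_sums (Suc n). x \<in> tile t)"
    unfolding tile_iff by (force simp: algebra_simps)
  finally show ?case .
qed

lemma expand_power: "(*) (real N ^ n) ` X = (\<Union>t\<in>digit_sums n. tile t)"
proof -
  have "x \<in> (*) (real N ^ n) ` X \<longleftrightarrow> x / real N ^ n \<in> X" for x
    using N_ge_2 by (auto simp: image_iff intro!: bexI[of _ "x / real N ^ n"])
  then show ?thesis using expand_power_iff by (intro set_eqI) (simp only: UN_iff)
qed

text \<open>Inclusion-exclusion: an overlap of two tiles lowers the measure of the union below the
  number of tiles times the measure of \<open>X\<close>, and \<open>big\<close> leaves no room for
  that.\<close>

lemma negligible_overlap_of_measure_Union:
  assumes I: "finite I" "s \<in> I" "t \<in> I" "s \<noteq> t"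
    and big: "real (card I) * measure lebesgue X \<le> measure lebesgue (\<Union>i\<in>I. tile i)"
  shows "negligible (tile s \<inter> tile t)"
proof -
  let ?m = "measure lebesgue"
  have "(\<Union>i\<in>I. tile i) = (tile s \<union> tile t) \<union> (\<Union>i\<in>I - {s, t}. tile i)"
    using I by auto
  then have "?m (\<Union>i\<in>I. tile i) \<le> ?m (tile s \<union> tile t) + ?m (\<Union>i\<in>I - {s, t}. tile i)"
    using I(1) lmeasurable_tile by (metis (no_types, lifting) finite_Diff fmeasurable.Un fmeasurable.finite_UN measure_Un_le fmeasurableD)
  also have "?m (tile s \<union> tile t) = ?m (tile s) + ?m (tile t) - ?m (tile s \<inter> tile t)"
    using lmeasurable_tile by (simp add: measure_Un3)
  also have "?m (\<Union>i\<in>I - {s, t}. tile i) \<le> (\<Sum>i\<in>I - {s, t}. ?m (tile i))"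
    using I(1) lmeasurable_tile by (intro measure_UNION_le) (auto intro: fmeasurableD)
  also have "(\<Sum>i\<in>I - {s, t}. ?m (tile i)) = (real (card I) - 2) * ?m X"
  proof -
    have "card {s, t} \<le> card I" using I by (intro card_mono) auto
    then have "real (card (I - {s, t})) = real (card I) - 2"
      using I by (subst card_Diff_subset) (auto simp: of_nat_diff)
    then show ?thesis by (simp add: measure_tile)
  qed
  finally have "?m (tile s \<inter> tile t) \<le> 0"
    using big measure_tile[of s] measure_tile[of t] by (simp only: left_diff_distrib) simp
  then have "?m (tile s \<inter> tile t) = 0"
    by (simp add: measure_le_0_iff)
  then show ?thesis
    using lmeasurable_tile by (simp add: negligible_iff_measure0 fmeasurable.Int)
qed

text \<open>The tiles at \<open>digit_sums n\<close> fill a set of measure \<open>N ^ n\<close>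
  times that of \<open>X\<close>, and there are at most \<open>N ^ n\<close> of them, so no overlap
  can be afforded.\<close>

lemma negligible_tile_Int_digit_sums:
  assumes "s \<in> digit_sums n" "t \<in> digit_sums n" "s \<noteq> t"
  shows "negligible (tile s \<inter> tile t)"
proof (rule negligible_overlap_of_measure_Union[OF finite_digit_sums assms])
  have "real (card (digit_sums n)) * measure lebesgue X \<le> real N ^ n * measure lebesgue X"
    using card_digit_sums_le[of n] by (intro mult_right_mono) (metis of_nat_le_iff of_nat_power, simp)
  also have "\<dots> = measure lebesgue ((*) (real N ^ n) ` X)"
    using measure_lebesgue_affine[of "real N ^ n" 0 X] by (simp add: abs_mult)
  finally show "real (card (digit_sums n)) * measure lebesgue X
      \<le> measure lebesgue (\<Union>i\<in>digit_sums n. tile i)"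
    unfolding expand_power .
qed

text \<open>If \<open>t - s = a - b\<close> with digit sums \<open>a\<close>, \<open>b\<close> of
  one level, translation by \<open>s - b\<close> carries \<open>tile b\<close> and
  \<open>tile a\<close> to \<open>tile s\<close> and \<open>tile t\<close>.\<close>

lemma negligible_tile_Int:
  assumes "t - s \<in> differences" "s \<noteq> t"
  shows "negligible (tile s \<inter> tile t)"
proof -
  from assms obtain n a b where *: "a \<in> digit_sums n" "b \<in> digit_sums n" "t - s = a - b"
    by (auto simp: differences_def)
  have "negligible (tile b \<inter> tile a)"
    using * assms(2) by (intro negligible_tile_Int_digit_sums) auto
  then have "negligible ((+) (s - b) ` (tile b \<inter> tile a))"
    by (rule negligible_translation)
  also have "(+) (s - b) ` (tile b \<inter> tile a) = tile s \<inter> tile t"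
  proof -
    have "(+) (s - b) ` (tile b \<inter> tile a) = (+) (s - b) ` tile b \<inter> (+) (s - b) ` tile a"
      by (rule image_Int) simp
    moreover have "s - b + b = s" "s - b + a = t" using *(3) by auto
    ultimately show ?thesis by (simp add: image_image add.assoc[symmetric])
  qed
  finally show ?thesis .
qed

lemma zero_in_differences: "0 \<in> differences"
proof -
  have "(0::real) - 0 \<in> differences"
    unfolding differences_def using zero_in_digit_sums by blast
  then show ?thesis by simp
qed

lemma D_subset_differences: "D \<subseteq> differences"
proof
  fix d assume "d \<in> D"
  then have "d \<in> digit_sums (Suc 0)" "0 \<in> digit_sums (Suc 0)" using zero_in_D by force+
  then have "d - 0 \<in> differences" unfolding differences_def by blast
  then show "d \<in> differences" by simp
qed

text \<open>Appending a last digit to both expansions of a difference. This closure is what lets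
  inflated tilings be tilings again.\<close>

lemma differences_expand:
  assumes "u \<in> differences" "d \<in> D" "e \<in> D"
  shows "(d - e) + real N * u \<in> differences"
proof -
  from assms obtain n s t where *: "s \<in> digit_sums n" "t \<in> digit_sums n" "u = s - t"
    by (auto simp: differences_def)
  have "d + real N * s \<in> digit_sums (Suc n)" "e + real N * t \<in> digit_sums (Suc n)"
    using * assms by force+
  moreover have "(d - e) + real N * u = (d + real N * s) - (e + real N * t)"
    unfolding *(3) by (simp add: algebra_simps)
  ultimately show ?thesis unfolding differences_def by blast
qed

lemma mult_power_differences: "u \<in> differences \<Longrightarrow> real N ^ n * u \<in> differences"
proof (induction n)
  case (Suc n)
  then show ?case using differences_expand[of "real N ^ n * u" 0 0] zero_in_D by (simp add: mult.assoc)
qed simp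

section \<open>Tilings of the line by translates of the tile\<close>

text \<open>Disjointness is encoded by the offsets instead of by null overlaps. It implies the
  latter (\<open>tiling_negligible\<close>), survives inflation, and reduces finiteness and
  integrality of tilings to properties of the single set \<open>differences\<close>.\<close>

definition is_tiling :: "real set \<Rightarrow> bool" where
  "is_tiling A \<longleftrightarrow> (\<Union>t\<in>A. tile t) = UNIV \<and> (\<forall>s\<in>A. \<forall>t\<in>A. s - t \<in> differences)"

lemma is_tilingD:
  assumes "is_tiling A"
  shows "\<exists>t\<in>A. x \<in> tile t" "s \<in> A \<Longrightarrow> t \<in> A \<Longrightarrow> s - t \<in> differences"
proof -
  have "(\<Union>t\<in>A. tile t) = UNIV" using assms by (simp only: is_tiling_def)
  then have "x \<in> (\<Union>t\<in>A. tile t)" by (simp only: UNIV_I)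
  then show "\<exists>t\<in>A. x \<in> tile t" by (simp only: UN_iff)
qed (use assms in \<open>auto simp: is_tiling_def\<close>)

lemma tiling_negligible:
  "is_tiling A \<Longrightarrow> s \<in> A \<Longrightarrow> t \<in> A \<Longrightarrow> s \<noteq> t \<Longrightarrow> negligible (tile s \<inter> tile t)"
  using negligible_tile_Int is_tilingD(2) by blast

text \<open>Magnify the tiling by \<open>N\<close> and cut each magnified tile into the tiles at
  \<open>d + N * t\<close> with \<open>d\<close> in \<open>D\<close>.\<close>

lemma tiling_expand:
  assumes "is_tiling A"
  shows "is_tiling ((\<lambda>(d, t). d + real N * t) ` (D \<times> A))"
  unfolding is_tiling_def
proof (intro conjI ballI)
  have "\<exists>d\<in>D. \<exists>t\<in>A. x \<in> tile (d + real N * t)" for x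
  proof -
    obtain t where t: "t \<in> A" "x / real N - t \<in> X" using is_tilingD(1)[OF assms] tile_iff by blast
    then have "(x - real N * t) / real N \<in> X" using N_ge_2 by (simp add: field_simps)
    then obtain d where "d \<in> D" "x - real N * t - d \<in> X" using expand_iff by blast
    then show ?thesis using t unfolding tile_iff by (force simp: algebra_simps)
  qed
  then show "(\<Union>t\<in>(\<lambda>(d, t). d + real N * t) ` (D \<times> A). tile t) = UNIV"
    by fastforce
next
  fix s t assume "s \<in> (\<lambda>(d, t). d + real N * t) ` (D \<times> A)" "t \<in> (\<lambda>(d, t). d + real N * t) ` (D \<times> A)"
  then obtain d a e b where *: "d \<in> D" "e \<in> D" "a \<in> A" "b \<in> A" "s = d + real N * a" "t = e + real N * b"
    by auto
  then have "(d - e) + real N * (a - b) \<in> differences"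
    using differences_expand is_tilingD(2)[OF assms] by blast
  then show "s - t \<in> differences" using * by (simp add: algebra_simps)
qed

text \<open>Start from one tile taken twice. Each inflation of the tiling appends a digit to both
  copies, chosen as the expansions of \<open>u\<close> prescribe, most significant digit first. The
  resulting tiling depends on \<open>u\<close>.\<close>

lemma difference_in_tiling:
  assumes "is_tiling A" "u \<in> differences"
  obtains B x y where "is_tiling B" "x \<in> B" "y \<in> B" "u = y - x"
proof -
  have "\<exists>B x y. is_tiling B \<and> x \<in> B \<and> y \<in> B \<and> s - t = y - x"
    if "s \<in> digit_sums n" "t \<in> digit_sums n" for n s t
    using that
  proof (induction n arbitrary: s t)
    case 0
    obtain x where "x \<in> A" using is_tilingD(1)[OF assms(1)] by blast
    then show ?case using 0 assms(1) by (intro exI[of _ A] exI[of _ x]) auto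
  next
    case (Suc n)
    then obtain d s' e t' where *: "d \<in> D" "e \<in> D" "s' \<in> digit_sums n" "t' \<in> digit_sums n"
      "s = d + real N * s'" "t = e + real N * t'" by auto
    then obtain B x y where B: "is_tiling B" "x \<in> B" "y \<in> B" "s' - t' = y - x"
      using Suc.IH by blast
    have s': "s' = t' + y - x" using B(4) by simp
    have "s - t = (d + real N * y) - (e + real N * x)"
      unfolding *(5,6) s' by (simp add: algebra_simps)
    moreover have "d + real N * y \<in> (\<lambda>(d, t). d + real N * t) ` (D \<times> B)"
      "e + real N * x \<in> (\<lambda>(d, t). d + real N * t) ` (D \<times> B)"
      using B * by force+
    ultimately show ?case using tiling_expand[OF B(1)] by blast
  qed
  then show thesis using assms(2) that unfolding differences_def by blast
qed

end

section \<open>Nonempty interior\<close>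

text \<open>Enclose \<open>X\<close> in an open \<open>U\<close> of measure less than
  \<open>1 + \<eta>\<close> times that of \<open>X\<close>. On a fine enough grid all cells meeting
  \<open>X\<close> lie in \<open>U\<close>, and \<open>X\<close> fills at most
  \<open>1 - \<eta>\<close> of each, so its measure is at most
  \<open>(1 - \<eta>) * (1 + \<eta>)\<close> times itself.\<close>

lemma measure_compact_eq_0_if_porous:
  fixes X :: "real set"
  assumes X: "compact X" and \<eta>: "0 < \<eta>" "\<eta> \<le> 1"
    and h: "\<And>n. 0 < h n" "h \<longlonglongrightarrow> 0"
    and porous: "\<And>n (j::int). measure lebesgue (X \<inter> {real_of_int j * h n..(real_of_int j + 1) * h n}) \<le> (1 - \<eta>) * h n"
  shows "measure lebesgue X = 0"
proof (rule ccontr)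
  let ?m = "measure lebesgue"
  assume "?m X \<noteq> 0"
  then have pos: "0 < ?m X" by (simp add: zero_less_measure_iff)
  have lm: "X \<in> lmeasurable" using X by (rule lmeasurable_compact)
  obtain U where U: "open U" "X \<subseteq> U" "U - X \<in> lmeasurable" "emeasure lebesgue (U - X) < ennreal (\<eta> * ?m X)"
    using sets_lebesgue_outer_open[of X "\<eta> * ?m X"] lm pos \<eta>(1) by (metis fmeasurableD mult_pos_pos)
  have "?m (U - X) < \<eta> * ?m X"
    using U(3,4) by (simp add: emeasure_eq_measure2 ennreal_less_iff)
  moreover have lmU: "U \<in> lmeasurable"
    using fmeasurable.Un[OF U(3) lm] U(2) by (simp add: Un_absorb2)
  moreover have "?m (U - X) = ?m U - ?m X"
    using lm lmU U(2) by (intro measurable_measure_Diff) (auto intro: fmeasurableD)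
  ultimately have mU: "?m U < (1 + \<eta>) * ?m X" by (simp add: algebra_simps)
  obtain \<epsilon> where \<epsilon>: "\<epsilon> > 0" "(\<Union>x\<in>X. ball x \<epsilon>) \<subseteq> U"
    using compact_subset_open_imp_ball_epsilon_subset[OF X U(1,2)] .
  obtain n where n: "h n < \<epsilon>"
    using order_tendstoD(2)[OF h(2) \<epsilon>(1)] by (auto simp: eventually_sequentially)
  define H where "H = h n"
  have H: "0 < H" "H < \<epsilon>" using h(1) n by (auto simp: H_def)
  define I where "I j = {of_int j * H..(real_of_int j + 1) * H}" for j :: int
  define J where "J = {j. X \<inter> I j \<noteq> {}}"
  obtain B where B: "\<And>x. x \<in> X \<Longrightarrow> \<bar>x\<bar> \<le> B"
    using compact_imp_bounded[OF X] by (auto simp: bounded_real)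
  have "J \<subseteq> {\<lfloor>- B / H\<rfloor> - 1..\<lceil>B / H\<rceil>}"
  proof
    fix j assume "j \<in> J"
    then obtain x where x: "x \<in> X" "of_int j * H \<le> x" "x \<le> (real_of_int j + 1) * H"
      by (auto simp: J_def I_def)
    have "of_int j \<le> B / H" "- B / H \<le> of_int j + 1"
      using x B[OF x(1)] H(1) by (auto simp: field_simps abs_le_iff)
    then show "j \<in> {\<lfloor>- B / H\<rfloor> - 1..\<lceil>B / H\<rceil>}" by auto linarith+
  qed
  then have finJ: "finite J" by (rule finite_subset) simp
  have "X \<subseteq> (\<Union>j\<in>J. X \<inter> I j)"
  proof
    fix x assume "x \<in> X"
    have "of_int \<lfloor>x / H\<rfloor> * H \<le> x" "x \<le> (of_int \<lfloor>x / H\<rfloor> + 1) * H"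
      using H(1) of_int_floor_le[of "x / H"] real_of_int_floor_add_one_ge[of "x / H"]
      by (simp_all only: pos_le_divide_eq pos_divide_le_eq)
    then show "x \<in> (\<Union>j\<in>J. X \<inter> I j)"
      using \<open>x \<in> X\<close> by (auto simp: J_def I_def intro!: exI[of _ "\<lfloor>x / H\<rfloor>"])
  qed
  then have "X = (\<Union>j\<in>J. X \<inter> I j)" by blast
  then have "?m X = ?m (\<Union>j\<in>J. X \<inter> I j)" by simp
  also have "\<dots> \<le> (\<Sum>j\<in>J. ?m (X \<inter> I j))"
    using finJ lm by (intro measure_UNION_le) (auto simp: I_def intro!: fmeasurableD fmeasurable.Int)
  also have "\<dots> \<le> (\<Sum>j\<in>J. (1 - \<eta>) * H)"
    by (intro sum_mono) (simp add: I_def H_def porous)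
  also have "\<dots> = (1 - \<eta>) * (\<Sum>j\<in>J. ?m (I j))"
    using H(1) by (simp add: I_def sum_distrib_left algebra_simps)
  also have "(\<Sum>j\<in>J. ?m (I j)) = ?m (\<Union>j\<in>J. I j)"
  proof (rule measure_negligible_finite_Union_image[symmetric, OF finJ])
    show "pairwise (\<lambda>x y. negligible (I x \<inter> I y)) J"
    proof (rule pairwiseI)
      fix j k :: int assume "j \<noteq> k"
      show "negligible (I j \<inter> I k)"
      proof (cases "j < k")
        case True
        then have "of_int j + (1::real) \<le> of_int k" by linarith
        then have "(real_of_int j + 1) * H \<le> of_int k * H" using H by (intro mult_right_mono) auto
        then have "I j \<inter> I k \<subseteq> {of_int k * H}" by (auto simp: I_def)
        then show ?thesis using negligible_subset negligible_sing by blast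
      next
        case False
        then have "of_int k + (1::real) \<le> of_int j" using \<open>j \<noteq> k\<close> by linarith
        then have "(of_int k + 1) * H \<le> of_int j * H" using H by (intro mult_right_mono) auto
        then have "I j \<inter> I k \<subseteq> {of_int j * H}" by (auto simp: I_def)
        then show ?thesis using negligible_subset negligible_sing by blast
      qed
    qed
  qed (simp add: I_def)
  also have "?m (\<Union>j\<in>J. I j) \<le> ?m U"
  proof (rule measure_mono_fmeasurable)
    show "(\<Union>j\<in>J. I j) \<subseteq> U"
    proof
      fix x assume "x \<in> (\<Union>j\<in>J. I j)"
      then obtain j y where "y \<in> X" "y \<in> I j" "x \<in> I j" by (auto simp: J_def)
      then have "dist y x \<le> H" by (auto simp: I_def dist_real_def algebra_simps)
      then show "x \<in> U" using \<epsilon>(2) H(2) \<open>y \<in> X\<close> by fastforce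
    qed
  qed (use finJ lmU in \<open>auto simp: I_def intro!: fmeasurableD\<close>)
  finally have "?m X \<le> (1 - \<eta>) * ?m U" using \<eta>(2) by (simp add: mult_left_mono)
  also have "\<dots> \<le> (1 - \<eta>) * ((1 + \<eta>) * ?m X)"
    using mU \<eta>(2) by (intro mult_left_mono) auto
  also have "\<dots> = ?m X - \<eta>\<^sup>2 * ?m X"
    by (simp add: algebra_simps power2_eq_square)
  finally show False using pos \<eta>(1) by (simp add: mult_le_0_iff)
qed

text \<open>Empty interior gives a gap near every \<open>y\<close>; compactness makes its length
  independent of \<open>y\<close>.\<close>

lemma uniform_gap:
  fixes X :: "real set"
  assumes X: "compact X" "interior X = {}" and h: "0 < h"
  shows "\<exists>\<eta>>0. \<forall>y. \<exists>z. {z..z + \<eta>} \<subseteq> {y..y + h} \<and> {z..z + \<eta>} \<inter> X = {}"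
proof -
  obtain B where B: "\<And>x. x \<in> X \<Longrightarrow> \<bar>x\<bar> \<le> B"
    using compact_imp_bounded[OF X(1)] by (auto simp: bounded_real)
  \<comment> \<open>A gap in the middle half of the window at \<open>y\<close> also lies in the
    window at every point closer to \<open>y\<close> than \<open>h/4\<close>, so finitely many
    centres serve a whole interval.\<close>
  have gap: "\<exists>\<eta>>0. \<exists>z. {z..z + \<eta>} \<subseteq> {y + h/4..y + 3*h/4} \<and> {z..z + \<eta>} \<inter> X = {}" for y
  proof -
    have "\<not> {y + h/4<..<y + 3*h/4} \<subseteq> X"
      using X(2) h interior_maximal[of "{y + h/4<..<y + 3*h/4}" X] by auto
    then obtain w where "w \<in> {y + h/4<..<y + 3*h/4}" "w \<notin> X" by blast
    then have w: "y + h/4 < w" "w < y + 3*h/4" "w \<notin> X" by auto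
    have "open ({y + h/4<..<y + 3*h/4} - X)"
      using X(1) by (intro open_Diff) (auto intro: compact_imp_closed)
    then obtain e where e: "e > 0" "cball w e \<subseteq> {y + h/4<..<y + 3*h/4} - X"
      using w unfolding open_contains_cball
      by (metis DiffI greaterThanLessThan_iff)
    have "{w..w + e} \<subseteq> cball w e" by (auto simp: dist_real_def)
    then have "{w..w + e} \<subseteq> {y + h/4<..<y + 3*h/4} - X" using e(2) by blast
    then have "{w..w + e} \<subseteq> {y + h/4..y + 3*h/4}" "{w..w + e} \<inter> X = {}"
      by fastforce+
    then show ?thesis using e(1) by blast
  qed
  then obtain \<eta> z where gap: "\<And>y. \<eta> y > 0" "\<And>y. {z y..z y + \<eta> y} \<subseteq> {y + h/4..y + 3*h/4}"
    "\<And>y. {z y..z y + \<eta> y} \<inter> X = {}" by metis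
  \<comment> \<open>For \<open>y\<close> outside this interval the window from \<open>y\<close> to
    \<open>y + h\<close> misses \<open>X\<close> altogether.\<close>
  have "compact {- B - h..B}" by simp
  then obtain C where C: "C \<subseteq> {- B - h..B}" "finite C" "{- B - h..B} \<subseteq> (\<Union>c\<in>C. ball c (h/4))"
    using h by (elim compactE_image[where C = "{- B - h..B}" and f = "\<lambda>c. ball c (h/4)"]) auto
  define \<eta>0 where "\<eta>0 = Min (insert h (\<eta> ` C))"
  have \<eta>0: "\<eta>0 > 0" "\<eta>0 \<le> h" "\<And>c. c \<in> C \<Longrightarrow> \<eta>0 \<le> \<eta> c"
    using C(2) h gap(1) by (auto simp: \<eta>0_def)
  have "\<exists>z. {z..z + \<eta>0} \<subseteq> {y..y + h} \<and> {z..z + \<eta>0} \<inter> X = {}" for y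
  proof (cases "y \<in> {- B - h..B}")
    case True
    then obtain c where c: "c \<in> C" "\<bar>y - c\<bar> < h/4" using C(3) by (auto simp: dist_real_def abs_minus_commute)
    have "{z c..z c + \<eta>0} \<subseteq> {z c..z c + \<eta> c}" using \<eta>0(3)[OF c(1)] by auto
    moreover have "y \<le> c + h/4" "c + 3*h/4 \<le> y + h"
      using c(2) unfolding abs_less_iff by linarith+
    then have "{c + h/4..c + 3*h/4} \<subseteq> {y..y + h}" by simp
    ultimately show ?thesis using gap(2,3)[of c] by blast
  next
    case False
    have "{y..y + \<eta>0} \<inter> X = {}" using False B \<eta>0(2) by fastforce
    then show ?thesis using \<eta>0(2) by (intro exI[of _ y]) auto
  qed
  then show ?thesis using \<eta>0(1) by blast
qed

text \<open>Gaps are nested: inside the gap left by \<open>M\<close> translates,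
  \<open>uniform_gap\<close> at the scale of its length finds one avoiding a further translate. The
  final length depends on \<open>M\<close> and \<open>h\<close>, but not on where the translates
  sit.\<close>

lemma uniform_gap_translates:
  fixes X :: "real set"
  assumes X: "compact X" "interior X = {}" and h: "0 < h"
  shows "\<exists>\<eta>>0. \<forall>y C. finite C \<and> card C \<le> M \<longrightarrow>
      (\<exists>z. {z..z + \<eta>} \<subseteq> {y..y + h} \<and> (\<forall>c\<in>C. {z..z + \<eta>} \<inter> (+) c ` X = {}))"
proof (induction M)
  case 0
  show ?case using h by (intro exI[of _ h]) auto
next
  case (Suc M)
  then obtain \<eta> where \<eta>: "\<eta> > 0" "\<forall>y C. finite C \<and> card C \<le> M \<longrightarrow>
      (\<exists>z. {z..z + \<eta>} \<subseteq> {y..y + h} \<and> (\<forall>c\<in>C. {z..z + \<eta>} \<inter> (+) c ` X = {}))"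
    by (elim exE conjE) (rule that)
  obtain \<delta> where \<delta>: "\<delta> > 0" "\<forall>y. \<exists>z. {z..z + \<delta>} \<subseteq> {y..y + \<eta>} \<and> {z..z + \<delta>} \<inter> X = {}"
    using uniform_gap[OF X \<eta>(1)] by (elim exE conjE) (rule that)
  have "\<exists>z. {z..z + \<delta>} \<subseteq> {y..y + h} \<and> (\<forall>c\<in>C. {z..z + \<delta>} \<inter> (+) c ` X = {})"
    if C: "finite C" "card C \<le> Suc M" for y C
  proof -
    have "\<exists>c C'. C \<subseteq> insert c C' \<and> finite C' \<and> card C' \<le> M"
    proof (cases "C = {}")
      case False
      then obtain c where "c \<in> C" by blast
      then show ?thesis using C by (intro exI[of _ c] exI[of _ "C - {c}"]) (auto simp: card_Diff_singleton)
    qed (auto intro: exI[of _ "{}"])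
    then obtain c C' where C': "C \<subseteq> insert c C'" "finite C'" "card C' \<le> M" by blast
    obtain z where z: "{z..z + \<eta>} \<subseteq> {y..y + h}" "\<forall>c\<in>C'. {z..z + \<eta>} \<inter> (+) c ` X = {}"
      using \<eta>(2)[rule_format, OF conjI[OF C'(2,3)], of y] by (elim exE conjE) (rule that)
    obtain w where w: "{w..w + \<delta>} \<subseteq> {z - c..z - c + \<eta>}" "{w..w + \<delta>} \<inter> X = {}"
      using \<delta>(2)[rule_format, of "z - c"] by (elim exE conjE) (rule that)
    have sub: "{c + w..c + w + \<delta>} \<subseteq> {z..z + \<eta>}" using w(1) \<delta>(1) by auto
    moreover have "{c + w..c + w + \<delta>} \<inter> (+) c ` X = {}" using w(2) by auto
    ultimately show ?thesis using z C'(1) by (intro exI[of _ "c + w"] conjI ballI) (blast+)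
  qed
  then show ?case using \<delta>(1) by (intro exI[of _ \<delta>] conjI) blast+
qed

context self_affine_tile
begin

text \<open>The tiles at \<open>C\<close> are essentially disjoint and all lie between
  \<open>\<alpha>\<close> and \<open>\<beta> + 1\<close>; compare measures.\<close>

lemma card_packing_le:
  assumes "finite C" "\<And>s t. s \<in> C \<Longrightarrow> t \<in> C \<Longrightarrow> s - t \<in> differences"
    and "C \<subseteq> {\<alpha>..\<beta>}" "\<alpha> \<le> \<beta>"
  shows "real (card C) * measure lebesgue X \<le> \<beta> + 1 - \<alpha>"
proof -
  have "measure lebesgue (\<Union>t\<in>C. tile t) = (\<Sum>t\<in>C. measure lebesgue (tile t))"
    using assms(1,2) negligible_tile_Int lmeasurable_tile
    by (intro measure_negligible_finite_Union_image) (auto intro!: pairwiseI)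
  then have "real (card C) * measure lebesgue X = measure lebesgue (\<Union>t\<in>C. tile t)"
    by (simp add: measure_tile)
  also have "\<dots> \<le> measure lebesgue {\<alpha>..\<beta> + 1}"
  proof (rule measure_mono_fmeasurable)
    show "(\<Union>t\<in>C. tile t) \<subseteq> {\<alpha>..\<beta> + 1}"
      using assms(3) tile_subset by fastforce
  qed (use assms(1) lmeasurable_tile in \<open>auto intro!: fmeasurableD fmeasurable.finite_UN\<close>)
  also have "\<dots> = \<beta> + 1 - \<alpha>" using assms(4) by simp
  finally show ?thesis .
qed

text \<open>Magnified by \<open>N ^ n\<close>, a grid cell of length \<open>1 / N ^ n\<close> sees a
  bounded number of tiles over a unit interval. Without interior they leave a gap whose length is
  the same for all \<open>n\<close> and all cells, so \<open>X\<close> is porous at every scale and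
  hence null.\<close>

lemma interior_X_nonempty: "interior X \<noteq> {}"
proof
  assume int: "interior X = {}"
  \<comment> \<open>The tiles meeting a unit interval have offsets in a window of length 2; packing
    adds 1 for the length of a tile.\<close>
  define M where "M = nat \<lfloor>3 / measure lebesgue X\<rfloor>"
  obtain \<eta> where \<eta>: "\<eta> > 0" "\<forall>y C. finite C \<and> card C \<le> M \<longrightarrow>
      (\<exists>z. {z..z + \<eta>} \<subseteq> {y..y + 1} \<and> (\<forall>c\<in>C. {z..z + \<eta>} \<inter> tile c = {}))"
    using uniform_gap_translates[OF compact_X int zero_less_one, of M] by (elim exE conjE) (rule that)
  \<comment> \<open>The gap property without any tiles: it yields \<open>\<eta> \<le> 1\<close>,
    which the porosity lemma demands.\<close>
  have "\<exists>z. {z..z + \<eta>} \<subseteq> {0..0 + 1} \<and> (\<forall>c\<in>{}. {z..z + \<eta>} \<inter> tile c = {})"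
    by (rule \<eta>(2)[rule_format]) auto
  then have \<eta>1: "\<eta> \<le> 1" using \<eta>(1) by (auto simp: atLeastatMost_subset_iff)
  have "measure lebesgue (X \<inter> {real_of_int j * (1 / N ^ n)..(real_of_int j + 1) * (1 / N ^ n)})
      \<le> (1 - \<eta>) * (1 / N ^ n)" for n and j :: int
  proof -
    define C where "C = digit_sums n \<inter> {real_of_int j - 1..real_of_int j + 1}"
    have N: "0 < real N ^ n" using N_ge_2 by simp
    have finC: "finite C" by (simp add: C_def finite_digit_sums)
    have "real (card C) * measure lebesgue X \<le> (real_of_int j + 1) + 1 - (real_of_int j - 1)"
      by (rule card_packing_le[OF finC]) (auto simp: C_def differences_def)
    then have "real (card C) \<le> 3 / measure lebesgue X"
      using measure_X_pos by (simp add: field_simps)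
    then have "card C \<le> M" unfolding M_def by (simp add: le_nat_iff le_floor_iff)
    then obtain z where z: "{z..z + \<eta>} \<subseteq> {real_of_int j..real_of_int j + 1}" "\<forall>c\<in>C. {z..z + \<eta>} \<inter> tile c = {}"
      using \<eta>(2)[rule_format, OF conjI[OF finC \<open>card C \<le> M\<close>], of "real_of_int j"] by (elim exE conjE) (rule that)
    let ?I = "{real_of_int j..real_of_int j + 1}"
    have sub: "(*) (real N ^ n) ` X \<inter> ?I \<subseteq> ?I - {z..z + \<eta>}"
    proof
      fix x assume x: "x \<in> (*) (real N ^ n) ` X \<inter> ?I"
      then obtain t where t: "t \<in> digit_sums n" "x \<in> tile t" using expand_power by blast
      then have "t \<in> C" using x tile_subset[of t] by (auto simp: C_def)
      then show "x \<in> ?I - {z..z + \<eta>}" using z(2) t x by blast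
    qed
    have "(*) (real N ^ n) ` (X \<inter> {real_of_int j * (1 / N ^ n)..(real_of_int j + 1) * (1 / N ^ n)})
        = (*) (real N ^ n) ` X \<inter> ?I"
      using N by (auto simp: field_simps)
    then have "real N ^ n * measure lebesgue (X \<inter> {real_of_int j * (1 / N ^ n)..(real_of_int j + 1) * (1 / N ^ n)})
        = measure lebesgue ((*) (real N ^ n) ` X \<inter> ?I)"
      using measure_lebesgue_affine[of "real N ^ n" 0 "X \<inter> {real_of_int j * (1 / N ^ n)..(real_of_int j + 1) * (1 / N ^ n)}"]
      by simp
    also have "\<dots> \<le> measure lebesgue (?I - {z..z + \<eta>})"
    proof (rule measure_mono_fmeasurable[OF sub])
      have "compact ((*) (real N ^ n) ` X \<inter> ?I)"
        using compact_X by (intro compact_Int compact_continuous_image continuous_intros) auto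
      then show "(*) (real N ^ n) ` X \<inter> ?I \<in> sets lebesgue"
        by (intro fmeasurableD lmeasurable_compact)
    qed auto
    also have "\<dots> = 1 - \<eta>"
      using z(1) \<eta>(1) by (subst measurable_measure_Diff) auto
    finally show ?thesis using N by (simp add: field_simps)
  qed
  then have "measure lebesgue X = 0"
    using \<eta>(1) \<eta>1 N_ge_2
    by (intro measure_compact_eq_0_if_porous[OF compact_X, of \<eta> "\<lambda>n. 1 / real N ^ n"])
       (auto simp: LIMSEQ_divide_realpow_zero)
  then show False using measure_X_pos by simp
qed

end

section \<open>Tilings and commensurability of the digits\<close>

text \<open>Over the rationals \<open>x\<close> and \<open>y\<close> are linearly independent, so
  values prescribed on them extend to a rational-linear map of the reals.\<close>

lemma exists_additive_separating:
  fixes x y :: real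
  assumes "y \<noteq> 0" "x / y \<notin> \<rat>"
  shows "\<exists>\<psi>::real \<Rightarrow> real. (\<forall>a b. \<psi> (a + b) = \<psi> a + \<psi> b) \<and> \<psi> y = 0 \<and> \<psi> x = 1"
proof -
  interpret V: vector_space_pair "\<lambda>(q::rat) (r::real). of_rat q * r" "\<lambda>(q::rat) (r::real). of_rat q * r"
    by unfold_locales (simp_all add: algebra_simps of_rat_add of_rat_mult)
  have "V.vs1.independent {x, y}"
  proof (rule V.vs1.independent_insertI)
    show "x \<notin> V.vs1.span {y}"
    proof
      assume "x \<in> V.vs1.span {y}"
      then obtain q where "x = of_rat q * y" by (auto simp: V.vs1.span_singleton)
      then show False using assms by (auto simp: Rats_def)
    qed
    show "V.vs1.independent {y}"
      using assms(1) by (intro V.vs1.independent_insertI) (auto simp: V.vs1.independent_empty)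
  qed
  then obtain g where g: "Vector_Spaces.linear (\<lambda>(q::rat) (r::real). of_rat q * r) (\<lambda>(q::rat) (r::real). of_rat q * r) g"
    "\<forall>z\<in>{x, y}. g z = (if z = x then 1 else 0)"
    using V.linear_independent_extend[of "{x, y}" "\<lambda>z. if z = x then 1 else 0"] by blast
  moreover have "x \<noteq> y" using assms by auto
  ultimately show ?thesis
    by (intro exI[of _ g]) (auto simp: V.linear_add)
qed

lemma additive_scale_nat:
  fixes \<psi> :: "real \<Rightarrow> real"
  assumes "\<And>a b. \<psi> (a + b) = \<psi> a + \<psi> b"
  shows "\<psi> (real n * x) = real n * \<psi> x"
proof (induction n)
  case 0
  show ?case using assms[of 0 0] by simp
next
  case (Suc n)
  then show ?case using assms[of x "real n * x"] by (simp add: algebra_simps)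
qed

lemma common_denominator:
  fixes S :: "real set"
  assumes "finite S" "S \<subseteq> \<rat>"
  shows "\<exists>q::nat. 0 < q \<and> (\<forall>s\<in>S. real q * s \<in> \<int>)"
  using assms
proof (induction S rule: finite_induct)
  case empty
  show ?case by (intro exI[of _ 1]) auto
next
  case (insert s S)
  then obtain q :: nat where q: "0 < q" "\<forall>s\<in>S. real q * s \<in> \<int>" by auto
  obtain m n :: int where mn: "0 < n" "s = of_int m / of_int n"
    using insert.prems by (auto elim!: Rats_cases')
  have "real (q * nat n) * t \<in> \<int>" if "t \<in> insert s S" for t
  proof (cases "t = s")
    case True
    have "real (q * nat n) * s = of_int (int q * m)" using mn by simp
    then show ?thesis using True by (metis Ints_of_int)
  next
    case False
    then have "of_int n * (real q * t) \<in> \<int>" using that q(2) by (intro Ints_mult[OF Ints_of_int]) auto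
    then show ?thesis using mn(1) by (simp add: mult_ac)
  qed
  then show ?case using q(1) mn(1) by (intro exI[of _ "q * nat n"]) auto
qed

context self_affine_tile
begin

lemma interval_in_X:
  obtains a l where "0 < l" "{a..a + l} \<subseteq> X"
proof -
  obtain x where "x \<in> interior X" using interior_X_nonempty by blast
  then obtain e where "e > 0" "cball x e \<subseteq> X"
    by (meson interior_subset open_contains_cball open_interior subset_trans)
  moreover have "{x..x + e} \<subseteq> cball x e" by (auto simp: dist_real_def)
  ultimately show thesis using that[of e x] by blast
qed

lemma differences_expand_power:
  assumes "u \<in> differences" "s \<in> digit_sums k" "t \<in> digit_sums k"
  shows "(s - t) + real N ^ k * u \<in> differences"
  using assms(2,3)
proof (induction k arbitrary: s t)
  case 0
  then show ?case using assms(1) by simp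
next
  case (Suc k)
  then obtain d s' e t' where *: "d \<in> D" "e \<in> D" "s' \<in> digit_sums k" "t' \<in> digit_sums k"
    "s = d + real N * s'" "t = e + real N * t'" by auto
  have "(d - e) + real N * ((s' - t') + real N ^ k * u) \<in> differences"
    using Suc.IH * by (intro differences_expand) auto
  then show ?case by (simp add: * algebra_simps)
qed

text \<open>Blowing up around a fixed point of one of the contractions that lies in the interior of
  the tile gives nested finite patches which exhaust the line.\<close>

lemma exists_tiling:
  obtains A where "is_tiling A" "0 \<in> A"
proof -
  obtain a l where al: "0 < l" "{a..a + l} \<subseteq> X" by (rule interval_in_X)
  define x0 where "x0 = a + l / 2"
  have "x0 \<in> X" using al by (auto simp: x0_def)
  obtain k0 where k0: "2 / l < real N ^ k0"
    using real_arch_pow[of "real N" "2 / l"] N_ge_2 by auto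
  \<comment> \<open>\<open>k0\<close> makes \<open>1 / K\<close> smaller than half the interval in
    \<open>X\<close>; the \<open>Suc\<close> ensures \<open>K \<ge> 2\<close>, so that
    \<open>K - 1\<close> is a valid denominator.\<close>
  define k where "k = Suc k0"
  define K where "K = real N ^ k"
  have "1 \<le> real N ^ k0" using N_ge_2 by simp
  then have "real N ^ k0 * 2 \<le> K" unfolding K_def k_def using N_ge_2 by (simp add: mult_mono)
  then have K: "2 \<le> K" using \<open>1 \<le> real N ^ k0\<close> by linarith
  have "2 / l < K" using k0 \<open>real N ^ k0 * 2 \<le> K\<close> \<open>1 \<le> real N ^ k0\<close> by linarith
  then have K_inv: "1 / K < l / 2" using K al(1) by (simp add: field_simps)
  have "(K * x0) / real N ^ k \<in> X" using \<open>x0 \<in> X\<close> K N_ge_2 by (simp add: K_def)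
  then obtain t where t: "t \<in> digit_sums k" "K * x0 - t \<in> X"
    using expand_power_iff tile_iff by blast
  \<comment> \<open>The fixed point of the contraction taking \<open>x\<close> to
    \<open>(x + t) / K\<close>. Its image of the unit interval has length \<open>1 / K\<close> and
    contains both \<open>z\<close> and \<open>x0\<close>, so \<open>z\<close> stays in the interior
    of the interval around \<open>x0\<close>.\<close>
  define z where "z = t / (K - 1)"
  have Kz: "K * z = z + t" using K by (simp add: z_def field_simps)
  have "0 \<le> z" "z \<le> 1" using digit_sums_bounds[OF t(1)] K by (auto simp: z_def K_def[symmetric])
  moreover have "0 \<le> K * x0 - t" "K * x0 - t \<le> 1" using t(2) X_subset by auto
  ultimately have "\<bar>K * (z - x0)\<bar> \<le> 1" by (simp add: right_diff_distrib Kz abs_le_iff)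
  then have "K * \<bar>z - x0\<bar> \<le> 1" using abs_mult[of K "z - x0"] K by linarith
  then have "\<bar>z - x0\<bar> \<le> 1 / K" using K by (simp add: field_simps)
  then have "\<bar>z - x0\<bar> < l / 2" using K_inv by linarith
  define r where "r = l / 2 - \<bar>z - x0\<bar>"
  have r: "0 < r" using \<open>\<bar>z - x0\<bar> < l / 2\<close> by (simp add: r_def)
  have near: "x \<in> X" if "\<bar>x - z\<bar> \<le> r" for x
  proof -
    have "x \<in> {a..a + l}" using that unfolding r_def x0_def by (simp add: abs_if split: if_splits)
    then show ?thesis using al(2) by blast
  qed
  \<comment> \<open>The map taking \<open>x\<close> to \<open>K * x - t\<close> fixes
    \<open>z\<close>. \<open>A m\<close> lists the tiles into which its \<open>m\<close>-th iterate
    subdivides \<open>X\<close>.\<close>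
  define A where "A = rec_nat {0::real} (\<lambda>_ B. (\<lambda>(s, c). K * c + s - t) ` (digit_sums k \<times> B))"
  have A0: "A 0 = {0}" and ASuc: "A (Suc m) = (\<lambda>(s, c). K * c + s - t) ` (digit_sums k \<times> A m)" for m
    by (auto simp: A_def)
  have cover: "\<exists>c\<in>A m. x \<in> tile c" if "\<bar>x - z\<bar> \<le> K ^ m * r" for m x
    using that
  proof (induction m arbitrary: x)
    case 0
    then show ?case using near by (simp add: A0 tile_iff)
  next
    case (Suc m)
    have "(x + t) / K - z = (x - z) / K" using Kz K by (simp add: field_simps)
    then have "\<bar>(x + t) / K - z\<bar> \<le> K ^ m * r" using Suc.prems K by (simp add: field_simps)
    then obtain c where c: "c \<in> A m" "(x + t) / K - c \<in> X" using Suc.IH tile_iff by blast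
    have "(x + t - K * c) / real N ^ k \<in> X" using c(2) K by (simp add: K_def[symmetric] field_simps)
    then obtain s where s: "s \<in> digit_sums k" "x + t - K * c - s \<in> X"
      using expand_power_iff tile_iff by blast
    have "K * c + s - t \<in> A (Suc m)" using c s by (force simp: ASuc)
    moreover have "x \<in> tile (K * c + s - t)" unfolding tile_iff using s(2) by (simp add: algebra_simps)
    ultimately show ?case by blast
  qed
  have diff: "b - c \<in> differences" if "b \<in> A m" "c \<in> A m" for m b c
    using that
  proof (induction m arbitrary: b c)
    case 0
    then show ?case by (simp add: A0 zero_in_differences)
  next
    case (Suc m)
    then obtain s b' s' c' where *: "s \<in> digit_sums k" "s' \<in> digit_sums k" "b' \<in> A m" "c' \<in> A m"
      "b = K * b' + s - t" "c = K * c' + s' - t" by (auto simp: ASuc)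
    have "(s - s') + real N ^ k * (b' - c') \<in> differences"
      using Suc.IH * by (intro differences_expand_power) auto
    then show ?case by (simp add: * K_def algebra_simps)
  qed
  \<comment> \<open>Nesting rests on \<open>t\<close> being itself a digit sum: \<open>s = t\<close>
    and \<open>c = 0\<close> reproduce the offset 0.\<close>
  have "A m \<subseteq> A (Suc m)" for m
  proof (induction m)
    case 0
    have "(\<lambda>(s, c). K * c + s - t) (t, 0) \<in> A (Suc 0)"
      unfolding ASuc by (rule imageI) (simp add: A0 t(1))
    then show ?case by (simp add: A0)
  next
    case (Suc m)
    then show ?case unfolding ASuc[of "Suc m"] by (subst ASuc) blast
  qed
  then have mono: "A m \<subseteq> A n" if "m \<le> n" for m n
    using that by (rule lift_Suc_mono_le)
  have "is_tiling (\<Union>m. A m)"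
    unfolding is_tiling_def
  proof (intro conjI ballI)
    have "\<exists>m. \<exists>c\<in>A m. x \<in> tile c" for x
    proof -
      obtain m where "\<bar>x - z\<bar> / r < K ^ m" using real_arch_pow[of K "\<bar>x - z\<bar> / r"] K by auto
      then have "\<bar>x - z\<bar> \<le> K ^ m * r" using r by (simp add: field_simps)
      then show ?thesis using cover by blast
    qed
    then show "(\<Union>t\<in>(\<Union>m. A m). tile t) = UNIV" by blast
  next
    fix s t assume "s \<in> (\<Union>m. A m)" "t \<in> (\<Union>m. A m)"
    then obtain m n where "s \<in> A m" "t \<in> A n" by auto
    then have "s \<in> A (max m n)" "t \<in> A (max m n)"
      using mono[of m "max m n"] mono[of n "max m n"] by auto
    then show "s - t \<in> differences" by (rule diff)
  qed
  moreover have "0 \<in> (\<Union>m. A m)" using A0 by auto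
  ultimately show thesis by (rule that)
qed

section \<open>Finite local complexity and additive functions\<close>

definition cdf_X :: "real \<Rightarrow> real" where
  "cdf_X s = measure lebesgue (X \<inter> {..s})"

lemma lmeasurable_X_Int: "S \<in> sets borel \<Longrightarrow> X \<inter> S \<in> lmeasurable"
  using lmeasurable_X by (metis fmeasurable_Int_fmeasurable sets_completionI_sets sets_lborel)

lemma measure_tile_Int_Icc:
  assumes "p \<le> q"
  shows "measure lebesgue (tile t \<inter> {p..q}) = cdf_X (q - t) - cdf_X (p - t)"
proof -
  let ?A = "X \<inter> {..p - t}" and ?B = "X \<inter> {p - t..q - t}"
  have "(+) t ` ?B = tile t \<inter> {p..q}" by auto
  then have "measure lebesgue (tile t \<inter> {p..q}) = measure lebesgue ?B"
    by (metis measure_translation)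
  moreover have "cdf_X (q - t) = measure lebesgue (?A \<union> ?B)"
    unfolding cdf_X_def using assms by (intro arg_cong[where f = "measure lebesgue"]) auto
  moreover have "measure lebesgue (?A \<union> ?B) = measure lebesgue ?A + measure lebesgue ?B - measure lebesgue (?A \<inter> ?B)"
    by (intro measure_Un3 lmeasurable_X_Int) auto
  moreover have "measure lebesgue (?A \<inter> ?B) = 0"
    by (rule negligible_imp_measure0, rule negligible_subset[of "{p - t}"]) auto
  ultimately show ?thesis by (simp add: cdf_X_def)
qed

text \<open>If \<open>v\<close> and \<open>w\<close> are differences with
  \<open>0 \<noteq> v \<le> w \<le> v + l\<close>, the part of \<open>X\<close> between
  \<open>a + v\<close> and \<open>a + w\<close> lies in \<open>tile v\<close> through its copy of
  the interval, hence in the null set \<open>tile 0 \<inter> tile v\<close>, and the value does not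
  change. So nonzero differences in one grid cell of length \<open>l\<close> share a value;
  \<open>v = 0\<close> adds at most one more.\<close>

lemma finite_cdf_X_differences:
  assumes al: "0 < l" "{a..a + l} \<subseteq> X"
  shows "finite ((\<lambda>v. cdf_X (a + v)) ` (differences \<inter> {- R..R}))"
proof -
  have le: "cdf_X (a + v) = cdf_X (a + w)"
    if "w \<in> differences" "v \<in> differences" "v \<noteq> 0" "v \<le> w" "w \<le> v + l" for v w
  proof -
    have "cdf_X (a + w) - cdf_X (a + v) = measure lebesgue (X \<inter> {a + v..a + w})"
      using measure_tile_Int_Icc[of "a + v" "a + w" 0] that by simp
    also have "\<dots> = 0"
    proof (rule negligible_imp_measure0, rule negligible_subset)
      show "negligible (tile 0 \<inter> tile v)" using that by (intro negligible_tile_Int) auto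
      show "X \<inter> {a + v..a + w} \<subseteq> tile 0 \<inter> tile v"
      proof
        fix x assume x: "x \<in> X \<inter> {a + v..a + w}"
        then have "x - v \<in> {a..a + l}" using that by auto
        then show "x \<in> tile 0 \<inter> tile v" using x al(2) by (auto simp: tile_iff)
      qed
    qed
    finally show ?thesis by simp
  qed
  define c where "c v = \<lfloor>v / l\<rfloor>" for v
  have same: "cdf_X (a + v) = cdf_X (a + w)"
    if "w \<in> differences - {0}" "v \<in> differences - {0}" "c v = c w" for v w
  proof -
    have "\<bar>v / l - w / l\<bar> < 1" using that(3) unfolding c_def by linarith
    then have "\<bar>v - w\<bar> < l" using al(1) by (simp add: diff_divide_distrib[symmetric] field_simps)
    then have near: "v \<le> w + l" "w \<le> v + l" by linarith+
    show ?thesis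
    proof (cases "v \<le> w")
      case True
      then show ?thesis using that(1,2) near by (intro le) auto
    next
      case False
      then show ?thesis using that(1,2) near by (intro le[symmetric]) auto
    qed
  qed
  define pick where "pick k = (SOME v. v \<in> differences - {0} \<and> c v = k)" for k
  define f where "f k = cdf_X (a + pick k)" for k
  have eq: "cdf_X (a + v) = f (c v)" if v: "v \<in> differences - {0}" for v
  proof -
    have "\<exists>w. w \<in> differences - {0} \<and> c w = c v" using v by (intro exI[of _ v] conjI refl)
    from someI_ex[OF this] have "pick (c v) \<in> differences - {0} \<and> c (pick (c v)) = c v"
      unfolding pick_def .
    then show ?thesis unfolding f_def using same[of "pick (c v)" v] v by simp
  qed
  have "(\<lambda>v. cdf_X (a + v)) ` (differences \<inter> {- R..R}) \<subseteq> insert (cdf_X a) (f ` {c (- R)..c R})"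
  proof (intro image_subsetI)
    fix v assume v: "v \<in> differences \<inter> {- R..R}"
    have "- R / l \<le> v / l" "v / l \<le> R / l"
      using v al(1) by (intro divide_right_mono; simp)+
    then have "c (- R) \<le> c v" "c v \<le> c R" unfolding c_def by (simp_all add: floor_mono)
    then show "cdf_X (a + v) \<in> insert (cdf_X a) (f ` {c (- R)..c R})"
      using eq[of v] v by (cases "v = 0") auto
  qed
  then show ?thesis by (rule finite_subset) simp
qed

text \<open>Finite local complexity: the distance of two tiles of a tiling is the total measure of the
  pieces between copies of an interval of the tile, and each such piece takes only finitely many
  sizes.\<close>

lemma finite_differences: "finite (differences \<inter> {0<..2})"
proof -
  obtain a l where al: "0 < l" "{a..a + l} \<subseteq> X" by (rule interval_in_X)
  have a01: "0 \<le> a" "a \<le> 1" using al(1) subsetD[OF al(2), of a] X_subset by auto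
  obtain A where A: "is_tiling A" using exists_tiling by blast
  define V where "V = (\<lambda>v. cdf_X (a + v)) ` (differences \<inter> {- 4..4})"
  define W where "W = (\<lambda>(p, q). p - q) ` (V \<times> V)"
  have "finite W" unfolding W_def V_def using finite_cdf_X_differences[OF al] by blast
  \<comment> \<open>The relevant tiles have offsets between \<open>x - 1\<close> and
    \<open>y + 1\<close>, an interval of length at most 4; packing adds 1.\<close>
  define M where "M = nat \<lfloor>5 / measure lebesgue X\<rfloor>"
  have "u \<in> sum_list ` {xs. set xs \<subseteq> W \<and> length xs \<le> M}" if u: "u \<in> differences \<inter> {0<..2}" for u
  proof -
    obtain B x y where B: "is_tiling B" "x \<in> B" "y \<in> B" "u = y - x"
      using difference_in_tiling[OF A] u by blast
    \<comment> \<open>Shifting the window by \<open>a\<close> makes the cut points, seen from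
      \<open>tile t\<close>, equal to \<open>a + (x - t)\<close> and \<open>a + (y - t)\<close>,
      where \<open>cdf_X\<close> takes only the values in \<open>V\<close>.\<close>
    define C where "C = {t \<in> B. tile t \<inter> {x + a..y + a} \<noteq> {}}"
    have C_sub: "C \<subseteq> {x - 1..y + 1}"
      using tile_subset a01 by (fastforce simp: C_def)
    \<comment> \<open>Stated for finite subsets because \<open>C\<close> is not yet known to be
      finite.\<close>
    have card_le: "card G \<le> M" if "G \<subseteq> C" "finite G" for G
    proof -
      have "real (card G) * measure lebesgue X \<le> (y + 1) + 1 - (x - 1)"
      proof (rule card_packing_le)
        show "s - t \<in> differences" if "s \<in> G" "t \<in> G" for s t
          using that \<open>G \<subseteq> C\<close> is_tilingD(2)[OF B(1)] by (auto simp: C_def)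
      qed (use that C_sub B(4) u in auto)
      also have "\<dots> \<le> 5" using B(4) u by auto
      finally have "real (card G) \<le> 5 / measure lebesgue X"
        using measure_X_pos by (simp add: field_simps)
      then show ?thesis unfolding M_def by (simp add: le_nat_iff le_floor_iff)
    qed
    have finC: "finite C" and cardC: "card C \<le> M"
      using finite_if_finite_subsets_card_bdd[of C M] card_le by auto
    have Icc: "{x + a..y + a} = (\<Union>t\<in>C. tile t \<inter> {x + a..y + a})"
      using is_tilingD(1)[OF B(1)] by (fastforce simp: C_def)
    have "u = measure lebesgue {x + a..y + a}"
      using B(4) u by simp
    also have "\<dots> = measure lebesgue (\<Union>t\<in>C. tile t \<inter> {x + a..y + a})"
      by (rule arg_cong[OF Icc])
    also have "\<dots> = (\<Sum>t\<in>C. measure lebesgue (tile t \<inter> {x + a..y + a}))"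
    proof (rule measure_negligible_finite_Union_image[OF finC])
      show "tile t \<inter> {x + a..y + a} \<in> lmeasurable" for t
        using lmeasurable_tile by (intro fmeasurable.Int) auto
      show "pairwise (\<lambda>s t. negligible (tile s \<inter> {x + a..y + a} \<inter> (tile t \<inter> {x + a..y + a}))) C"
      proof (rule pairwiseI)
        fix s t assume "s \<in> C" "t \<in> C" "s \<noteq> t"
        then have "negligible (tile s \<inter> tile t)" by (intro tiling_negligible[OF B(1)]) (auto simp: C_def)
        then show "negligible (tile s \<inter> {x + a..y + a} \<inter> (tile t \<inter> {x + a..y + a}))"
          by (rule negligible_subset) blast
      qed
    qed
    also have "\<dots> = (\<Sum>t\<in>C. cdf_X (a + (y - t)) - cdf_X (a + (x - t)))"
      using B(4) u by (intro sum.cong refl) (simp add: measure_tile_Int_Icc algebra_simps)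
    finally have u_eq: "u = (\<Sum>t\<in>C. cdf_X (a + (y - t)) - cdf_X (a + (x - t)))" .
    obtain ts where ts: "set ts = C" "distinct ts" using finite_distinct_list[OF finC] by blast
    define xs where "xs = map (\<lambda>t. cdf_X (a + (y - t)) - cdf_X (a + (x - t))) ts"
    have "u = sum_list xs"
      unfolding u_eq xs_def using ts by (simp add: sum_list_distinct_conv_sum_set)
    moreover have "length xs \<le> M"
      using cardC ts by (simp add: xs_def distinct_card[symmetric])
    moreover have "set xs \<subseteq> W"
    proof -
      have "cdf_X (a + (y - t)) \<in> V" "cdf_X (a + (x - t)) \<in> V" if "t \<in> C" for t
      proof -
        have "t \<in> B" "x - 1 \<le> t" "t \<le> y + 1"
          using that subsetD[OF C_sub that] by (auto simp: C_def)
        then have "y - t \<in> differences \<inter> {- 4..4}" "x - t \<in> differences \<inter> {- 4..4}"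
          using is_tilingD(2)[OF B(1)] B u by auto
        then show "cdf_X (a + (y - t)) \<in> V" "cdf_X (a + (x - t)) \<in> V" by (auto simp: V_def)
      qed
      then show ?thesis by (auto simp: xs_def ts W_def)
    qed
    ultimately show ?thesis by blast
  qed
  then have "differences \<inter> {0<..2} \<subseteq> sum_list ` {xs. set xs \<subseteq> W \<and> length xs \<le> M}" by blast
  moreover have "finite (sum_list ` {xs. set xs \<subseteq> W \<and> length xs \<le> M})"
    using finite_lists_length_le[OF \<open>finite W\<close>] by (rule finite_imageI)
  ultimately show ?thesis by (rule finite_subset)
qed

text \<open>Realise \<open>u\<close> as an offset \<open>y - x\<close> in a tiling and insert the
  tile covering \<open>x + 3/2\<close>. Such splittings reduce long differences to those of length
  at most 2.\<close>

lemma split_difference: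
  assumes "u \<in> differences"
  obtains s where "s \<in> differences" "1/2 \<le> s" "s \<le> 3/2" "u - s \<in> differences"
proof -
  obtain A where "is_tiling A" using exists_tiling by blast
  then obtain B x y where B: "is_tiling B" "x \<in> B" "y \<in> B" "u = y - x"
    using difference_in_tiling assms by blast
  obtain t where t: "t \<in> B" "x + 3/2 \<in> tile t" using is_tilingD(1)[OF B(1)] by blast
  have "1/2 \<le> t - x" "t - x \<le> 3/2" using t(2) tile_subset[of t] by auto
  moreover have "u - (t - x) = y - t" using B(4) by simp
  ultimately show thesis using that[of "t - x"] is_tilingD(2)[OF B(1)] B t(1) by auto
qed

text \<open>The slope of an additive function attains its maximum over the positive differences, by
  finite local complexity. Inflating a maximising difference and splitting off one digit
  shows that every digit is maximising as well.\<close>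

lemma additive_linear_on_digits:
  fixes \<psi> :: "real \<Rightarrow> real"
  assumes add: "\<And>x y. \<psi> (x + y) = \<psi> x + \<psi> y"
  shows "\<exists>L. \<forall>d\<in>D. \<psi> d = L * d"
proof -
  have \<psi>0: "\<psi> 0 = 0" using add[of 0 0] by simp
  have \<psi>_diff: "\<psi> (x - y) = \<psi> x - \<psi> y" for x y using add[of "x - y" y] by simp
  define P where "P = differences \<inter> {0<..2}"
  have finP: "finite P" unfolding P_def by (rule finite_differences)
  obtain s where s: "s \<in> differences" "1/2 \<le> s" "s \<le> 3/2"
    by (rule split_difference[OF zero_in_differences])
  then have "s \<in> P" by (simp add: P_def)
  define L where "L = Max ((\<lambda>u. \<psi> u / u) ` P)"
  have "L \<in> (\<lambda>u. \<psi> u / u) ` P" unfolding L_def using finP \<open>s \<in> P\<close> by (intro Max_in) auto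
  then obtain u0 where u0: "u0 \<in> P" "L = \<psi> u0 / u0" by blast
  have small: "\<psi> u \<le> L * u" if "u \<in> P" for u
  proof -
    have "\<psi> u / u \<le> L" unfolding L_def using finP that by (intro Max_ge) auto
    then show ?thesis using that by (simp add: P_def field_simps)
  qed
  \<comment> \<open>Each splitting shortens \<open>u\<close> by at least \<open>1/2\<close>, hence
    the induction bound. For \<open>u > 2\<close> both parts are positive, since the split-off part
    is at most \<open>3/2\<close>.\<close>
  have bound: "\<psi> u \<le> L * u" if "u \<in> differences" "0 < u" "u \<le> 2 + real n / 2" for n u
    using that
  proof (induction n arbitrary: u)
    case 0
    then show ?case by (intro small) (simp add: P_def)
  next
    case (Suc n)
    show ?case
    proof (cases "u \<le> 2")
      case True
      then show ?thesis using Suc.prems by (intro small) (simp add: P_def)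
    next
      case False
      obtain s where s: "s \<in> differences" "1/2 \<le> s" "s \<le> 3/2" "u - s \<in> differences"
        using split_difference[OF Suc.prems(1)] .
      have "u - s \<le> 2 + real n / 2" using s(2) Suc.prems(3) by (simp add: field_simps)
      then have "\<psi> (u - s) \<le> L * (u - s)" using s False by (intro Suc.IH) auto
      moreover have "\<psi> s \<le> L * s" using s by (intro small) (auto simp: P_def)
      ultimately show ?thesis by (simp add: \<psi>_diff algebra_simps)
    qed
  qed
  have bound: "\<psi> u \<le> L * u" if "u \<in> differences" "0 < u" for u
  proof -
    obtain n :: nat where "2 * u \<le> real n" using real_arch_simple by blast
    then show ?thesis using bound[OF that, of n] by simp
  qed
  have "\<psi> d = L * d" if "d \<in> D" for d
  proof (cases "d = 0")
    case False
    then have d: "0 < d" "d \<in> differences" using D_bounds that D_subset_differences by force+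
    have u0_pos: "0 < u0" "u0 \<in> differences" using u0(1) by (auto simp: P_def)
    obtain m where m: "d / u0 < real N ^ m" using real_arch_pow[of "real N" "d / u0"] N_ge_2 by auto
    have "real N ^ m \<le> real N ^ Suc m" using N_ge_2 by (intro power_increasing) auto
    then have "d / u0 < real N ^ Suc m" using m by linarith
    then have less: "d < real N ^ Suc m * u0" using u0_pos by (simp add: field_simps)
    have "(0 - d) + real N * (real N ^ m * u0) \<in> differences"
      using that zero_in_D mult_power_differences[OF u0_pos(2)] by (intro differences_expand)
    then have "real N ^ Suc m * u0 - d \<in> differences" by (simp add: algebra_simps)
    then have "\<psi> (real N ^ Suc m * u0 - d) \<le> L * (real N ^ Suc m * u0 - d)"
      using less by (intro bound) auto
    \<comment> \<open>The inflated \<open>u0\<close> still attains the slope \<open>L\<close>.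
      Subtracting this equality from the upper bound for the difference reverses the inequality at
      \<open>d\<close>.\<close>
    moreover have "\<psi> (real N ^ Suc m * u0) = L * (real N ^ Suc m * u0)"
    proof -
      have "\<psi> (real (N ^ Suc m) * u0) = real (N ^ Suc m) * \<psi> u0"
        by (rule additive_scale_nat) (rule add)
      then show ?thesis using u0 u0_pos by simp
    qed
    ultimately have "L * d \<le> \<psi> d" by (simp add: \<psi>_diff algebra_simps)
    then show ?thesis using bound[OF d(2,1)] by simp
  qed (simp add: \<psi>0)
  then show ?thesis by blast
qed

text \<open>Otherwise some additive function vanishes at \<open>e\<close> and not at
  \<open>d\<close>; proportionality on \<open>D\<close> would give it slope 0 because
  \<open>e \<noteq> 0\<close>.\<close>

lemma digit_ratio_rational:
  assumes "d \<in> D" "e \<in> D" "e \<noteq> 0"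
  shows "d / e \<in> \<rat>"
proof (rule ccontr)
  assume "d / e \<notin> \<rat>"
  then obtain \<psi> :: "real \<Rightarrow> real" where \<psi>: "\<And>a b. \<psi> (a + b) = \<psi> a + \<psi> b" "\<psi> e = 0" "\<psi> d = 1"
    using exists_additive_separating[OF assms(3)] by blast
  then show False using additive_linear_on_digits[of \<psi>] assms by auto
qed

end

section \<open>Tiling the integers\<close>

context self_affine_tile
begin

lemma tile_nonnegligible: "\<not> negligible (tile t)"
  using measure_X_pos measure_tile[of t] negligible_imp_measure0[of "tile t"] by auto

text \<open>Were one new tile produced from two distinct tiles \<open>a\<close> and
  \<open>b\<close>, it would lie in the magnified overlap of these two, a null set, although tiles
  have positive measure.\<close>

lemma inj_on_expand_tiling:
  assumes A: "is_tiling A"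
  shows "inj_on (\<lambda>(d, t). d + real N * t) (D \<times> A)"
proof (rule inj_onI, clarify)
  fix d a e b
  assume *: "d \<in> D" "a \<in> A" "e \<in> D" "b \<in> A" "d + real N * a = e + real N * b"
  have "a = b"
  proof (rule ccontr)
    assume "a \<noteq> b"
    then have "negligible (tile a \<inter> tile b)" using tiling_negligible[OF A] * by blast
    then have "measure lebesgue ((*) (real N) ` (tile a \<inter> tile b)) = 0"
      using measure_lebesgue_affine[of "real N" 0 "tile a \<inter> tile b"] by (simp add: negligible_imp_measure0)
    moreover have "compact ((*) (real N) ` (tile a \<inter> tile b))"
      by (rule compact_continuous_image[OF _ compact_Int[OF compact_tile compact_tile]])
        (intro continuous_intros)
    ultimately have "negligible ((*) (real N) ` (tile a \<inter> tile b))"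
      using lmeasurable_compact negligible_iff_measure by blast
    moreover have "tile (d + real N * a) \<subseteq> (*) (real N) ` (tile a \<inter> tile b)"
    proof
      fix x assume x: "x \<in> tile (d + real N * a)"
      have "x / real N - c \<in> X" if "f \<in> D" "d + real N * a = f + real N * c" for f c
      proof -
        have "x - real N * c - f \<in> X" using x[unfolded tile_iff] that by (simp add: algebra_simps)
        then have "(x - real N * c) / real N \<in> X" using expand_iff that by blast
        then show ?thesis using N_ge_2 by (simp add: field_simps)
      qed
      then have "x / real N \<in> tile a \<inter> tile b" using * by (auto simp only: tile_iff Int_iff)
      then show "x \<in> (*) (real N) ` (tile a \<inter> tile b)"
        using N_ge_2 by (intro image_eqI[of _ _ "x / real N"]) auto
    qed
    ultimately show False using negligible_subset tile_nonnegligible by blast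
  qed
  then show "d = e \<and> a = b" using * by simp
qed

lemma digit_sums_integral:
  assumes "\<And>d. d \<in> D \<Longrightarrow> \<sigma> * d \<in> \<int>"
  shows "t \<in> digit_sums n \<Longrightarrow> \<sigma> * t \<in> \<int>"
proof (induction n arbitrary: t)
  case (Suc n)
  then obtain d s where *: "d \<in> D" "s \<in> digit_sums n" "t = d + real N * s" by auto
  have "\<sigma> * d + of_nat N * (\<sigma> * s) \<in> \<int>"
    using Suc.IH[OF *(2)] assms[OF *(1)] by (simp add: Ints_add Ints_mult)
  then show ?case using * by (simp add: algebra_simps)
qed simp

lemma differences_integral:
  assumes "\<And>d. d \<in> D \<Longrightarrow> \<sigma> * d \<in> \<int>" "u \<in> differences"
  shows "\<sigma> * u \<in> \<int>"
proof -
  obtain n s t where "s \<in> digit_sums n" "t \<in> digit_sums n" "u = s - t"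
    using assms(2) by (auto simp: differences_def)
  then show ?thesis
    using digit_sums_integral[OF assms(1)] by (simp add: right_diff_distrib Ints_diff)
qed

text \<open>For almost every \<open>y\<close> each point \<open>y + z / \<sigma>\<close> lies in
  exactly one tile. If its offset is \<open>d + N * t\<close>, the integer
  \<open>\<sigma> * d\<close> becomes the first summand of \<open>z\<close>, and the remainder
  belongs to \<open>E\<close>.\<close>

lemma integer_digits_tile:
  assumes \<sigma>: "0 < \<sigma>" and int: "\<And>d. d \<in> D \<Longrightarrow> \<sigma> * d \<in> \<int>"
  shows "\<exists>D' E::int set. of_int ` D' = (*) \<sigma> ` D \<and> direct_sum_Z D' E"
proof -
  obtain A where A: "is_tiling A" "0 \<in> A" by (rule exists_tiling)
  let ?g = "\<lambda>(d, t). d + real N * t"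
  have A_int: "\<sigma> * t \<in> \<int>" if "t \<in> A" for t
    using differences_integral[OF int] is_tilingD(2)[OF A(1) that A(2)] by simp
  \<comment> \<open>The inflated tiling is used because each of its offsets contains exactly one
    digit as a summand, by \<open>inj_on_expand_tiling\<close>.\<close>
  define B where "B = ?g ` (D \<times> A)"
  have B: "is_tiling B" unfolding B_def by (rule tiling_expand[OF A(1)])
  have "A \<subseteq> range (\<lambda>k::int. of_int k / \<sigma>)"
  proof
    fix t assume "t \<in> A"
    then obtain k where "\<sigma> * t = of_int k" using A_int by (auto elim: Ints_cases)
    then have "t = of_int k / \<sigma>" using \<sigma> by (simp add: field_simps)
    then show "t \<in> range (\<lambda>k::int. of_int k / \<sigma>)" by blast
  qed
  then have "countable A" by (rule countable_subset) simp
  then have "countable B" unfolding B_def using finite_D by (intro countable_image countable_SIGMA) (auto intro: countable_finite)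
  \<comment> \<open>Integrality makes the tiling countable, so the overlaps, shifted by all
    multiples of \<open>1 / \<sigma>\<close>, form a null set that \<open>y\<close> can
    avoid.\<close>
  define P where "P = (UNIV :: int set) \<times> {(s, t) \<in> B \<times> B. s \<noteq> t}"
  define overlap where "overlap = (\<lambda>(z::int, s, t). (+) (- (of_int z / \<sigma>)) ` (tile s \<inter> tile t))"
  define Z where "Z = \<Union>(overlap ` P)"
  have "countable {(s, t) \<in> B \<times> B. s \<noteq> t}"
    by (rule countable_subset[of _ "B \<times> B"]) (auto intro: \<open>countable B\<close>)
  then have "countable P" unfolding P_def by (intro countable_SIGMA) auto
  then have "negligible Z"
    unfolding Z_def
  proof (intro negligible_countable_Union countable_image)
    fix S assume "S \<in> overlap ` P"
    then obtain z s t where "s \<in> B" "t \<in> B" "s \<noteq> t"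
      and S: "S = (+) (- (of_int z / \<sigma>)) ` (tile s \<inter> tile t)"
      by (auto simp: P_def overlap_def)
    then show "negligible S"
      unfolding S by (intro negligible_translation tiling_negligible[OF B])
  qed
  then obtain y where y: "y \<notin> Z" using non_negligible_UNIV by (metis UNIV_eq_I)
  have unique: "s = t" if "s \<in> B" "t \<in> B" "y + of_int z / \<sigma> \<in> tile s" "y + of_int z / \<sigma> \<in> tile t" for s t and z :: int
  proof (rule ccontr)
    assume "s \<noteq> t"
    have "y = (+) (- (of_int z / \<sigma>)) (y + of_int z / \<sigma>)" by simp
    then have "y \<in> (+) (- (of_int z / \<sigma>)) ` (tile s \<inter> tile t)"
      using that(3,4) by blast
    then have "y \<in> overlap (z, s, t)" by (simp only: overlap_def prod.case)
    moreover have "(z, s, t) \<in> P" using that(1,2) \<open>s \<noteq> t\<close> by (simp add: P_def)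
    ultimately show False using y unfolding Z_def by blast
  qed
  define D' where "D' = {k::int. of_int k \<in> (*) \<sigma> ` D}"
  have D': "of_int ` D' = (*) \<sigma> ` D"
  proof
    show "(*) \<sigma> ` D \<subseteq> of_int ` D'"
    proof
      fix v assume v: "v \<in> (*) \<sigma> ` D"
      then obtain k :: int where "v = of_int k" using int by (auto elim!: Ints_cases)
      then show "v \<in> of_int ` D'" using v by (auto simp: D'_def)
    qed
  qed (auto simp: D'_def)
  \<comment> \<open>Here \<open>y + k / \<sigma>\<close> is the position of the point inside the
    untranslated tile, and \<open>\<sigma> * (N * t)\<close> is the integer contributed by the
    offset without its digit.\<close>
  define E where "E = {e::int. \<exists>k::int. \<exists>t\<in>A. of_int e = of_int k + \<sigma> * (real N * t) \<and> y + of_int k / \<sigma> \<in> X}"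
  have "\<exists>!de. fst de \<in> D' \<and> snd de \<in> E \<and> z = fst de + snd de" for z
  proof (rule ex_ex1I)
    obtain d t where dt: "d \<in> D" "t \<in> A" "y + of_int z / \<sigma> \<in> tile (d + real N * t)"
      using is_tilingD(1)[OF B, of "y + of_int z / \<sigma>"] unfolding B_def by auto
    obtain d' where d': "\<sigma> * d = of_int d'" using int[OF dt(1)] by (auto elim: Ints_cases)
    obtain t' where t': "\<sigma> * t = of_int t'" using A_int[OF dt(2)] by (auto elim: Ints_cases)
    define k where "k = z - d' - int N * t'"
    have "of_int k / \<sigma> = of_int z / \<sigma> - d - real N * t"
      using \<sigma> d' t' by (simp add: k_def field_simps)
    then have "y + of_int k / \<sigma> = y + of_int z / \<sigma> - (d + real N * t)" by simp
    then have "y + of_int k / \<sigma> \<in> X" using dt(3)[unfolded tile_iff] by (simp only:)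
    moreover have "of_int (z - d') = of_int k + \<sigma> * (real N * t)"
      using t' by (simp add: k_def algebra_simps)
    ultimately have "z - d' \<in> E" using dt(2) unfolding E_def by blast
    moreover have "d' \<in> D'" unfolding D'_def mem_Collect_eq d'[symmetric] using dt(1) by (rule imageI)
    ultimately show "\<exists>de. fst de \<in> D' \<and> snd de \<in> E \<and> z = fst de + snd de"
      by (intro exI[of _ "(d', z - d')"]) simp
  next
    fix p q assume pq: "fst p \<in> D' \<and> snd p \<in> E \<and> z = fst p + snd p" "fst q \<in> D' \<and> snd q \<in> E \<and> z = fst q + snd q"
    have ex: "\<exists>d\<in>D. \<exists>t\<in>A. of_int (fst r) = \<sigma> * d \<and> y + of_int z / \<sigma> \<in> tile (d + real N * t)"
      if r: "fst r \<in> D' \<and> snd r \<in> E \<and> z = fst r + snd r" for r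
    proof -
      obtain d where d: "d \<in> D" "of_int (fst r) = \<sigma> * d" using r by (auto simp: D'_def)
      obtain k :: int and t where k: "t \<in> A" "of_int (snd r) = of_int k + \<sigma> * (real N * t)" "y + of_int k / \<sigma> \<in> X"
        using r by (auto simp: E_def)
      have "real_of_int z = of_int k + \<sigma> * (d + real N * t)"
        using r d k by (simp add: algebra_simps)
      then have "of_int z / \<sigma> = of_int k / \<sigma> + (d + real N * t)" using \<sigma> by (simp add: field_simps)
      then have "y + of_int z / \<sigma> \<in> tile (d + real N * t)"
        using k(3) unfolding tile_iff by (simp add: algebra_simps)
      then show ?thesis using d k(1) by blast
    qed
    obtain d a where da: "d \<in> D" "a \<in> A" "of_int (fst p) = \<sigma> * d" "y + of_int z / \<sigma> \<in> tile (d + real N * a)"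
      using ex[OF pq(1)] by blast
    obtain e b where eb: "e \<in> D" "b \<in> A" "of_int (fst q) = \<sigma> * e" "y + of_int z / \<sigma> \<in> tile (e + real N * b)"
      using ex[OF pq(2)] by blast
    have "d + real N * a = e + real N * b"
      using da eb by (intro unique[of _ _ z]) (force simp: B_def)+
    then have "(d, a) = (e, b)"
      using inj_onD[OF inj_on_expand_tiling[OF A(1)], of "(d, a)" "(e, b)"] da eb by simp
    then have "real_of_int (fst p) = real_of_int (fst q)" using da eb by simp
    then show "p = q" using pq by (simp add: prod_eq_iff)
  qed
  then have "direct_sum_Z D' E" unfolding direct_sum_Z_def by blast
  then show ?thesis using D' by blast
qed

theorem digits_tile_integers:
  "\<exists>\<sigma>>0. \<exists>D' E::int set. of_int ` D' = (*) \<sigma> ` D \<and> direct_sum_Z D' E"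
proof -
  have "D \<noteq> {0}" using card_D N_ge_2 by auto
  then obtain e where e: "e \<in> D" "e \<noteq> 0" using zero_in_D by blast
  then have "0 < e" using D_bounds by force
  have "(\<lambda>d. d / e) ` D \<subseteq> \<rat>" using digit_ratio_rational e by blast
  then obtain q :: nat where q: "0 < q" "\<forall>s\<in>(\<lambda>d. d / e) ` D. real q * s \<in> \<int>"
    using common_denominator[of "(\<lambda>d. d / e) ` D"] finite_D by blast
  have "0 < real q / e" using q(1) \<open>0 < e\<close> by simp
  moreover have "real q / e * d \<in> \<int>" if "d \<in> D" for d using q(2) that by simp
  ultimately show ?thesis using integer_digits_tile[of "real q / e"] by blast
qed

end

section \<open>Tight frame measures and Gaussian averages\<close>

context real_distribution
begin

definition indicator_transform :: "real set \<Rightarrow> real \<Rightarrow> complex" where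
  "indicator_transform A t = (CLINT x|M. indicator A x * iexp (- (2 * pi * t) * x))"

definition energy :: "real set \<Rightarrow> ennreal" where
  "energy A = (\<integral>\<^sup>+t. ennreal ((cmod (indicator_transform A t))\<^sup>2) \<partial>lborel)"

lemma measurable_indicator_transform [measurable]:
  assumes [measurable]: "A \<in> sets borel"
  shows "indicator_transform A \<in> borel_measurable borel"
  unfolding indicator_transform_def by measurable

lemma fourier_meas_modulated_indicator:
  "fourier_meas M (\<lambda>x. indicator A x * iexp (2 * pi * s * x)) t = indicator_transform A (t - s)"
  unfolding fourier_meas_def indicator_transform_def
  by (intro Bochner_Integration.integral_cong refl)
     (simp add: mult.assoc exp_add[symmetric] algebra_simps)

lemma in_L2_modulated_indicator:
  assumes [measurable]: "A \<in> sets borel"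
  shows "in_L2 M (\<lambda>x. indicator A x * iexp (2 * pi * s * x))"
proof -
  have "(\<lambda>x. (cmod (indicator A x * iexp (2 * pi * s * x)))\<^sup>2) = indicator A"
    by (auto simp: norm_mult indicator_def)
  then show ?thesis unfolding in_L2_def by (auto simp: integrable_indicator_iff less_top[symmetric])
qed

text \<open>Modulating an indicator leaves its norm unchanged and translates its transform, so the
  frame identity holds for all translates with one constant.\<close>

lemma tight_frame_translated_transform:
  assumes \<nu>: "tight_frame_measure M \<nu>"
  obtains a :: real where "0 < a"
    "\<And>A s. A \<in> sets borel \<Longrightarrow>
      (\<integral>\<^sup>+t. ennreal ((cmod (indicator_transform A (t - s)))\<^sup>2) \<partial>\<nu>) = ennreal a * emeasure M A"
proof -
  obtain a where a: "0 < a" "\<And>f. in_L2 M f \<Longrightarrow>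
        (\<integral>\<^sup>+ t. ennreal ((cmod (fourier_meas M f t))\<^sup>2) \<partial>\<nu>)
          = ennreal a * (\<integral>\<^sup>+ x. ennreal ((cmod (f x))\<^sup>2) \<partial>M)"
    using \<nu> unfolding tight_frame_measure_def by blast
  have "(\<integral>\<^sup>+t. ennreal ((cmod (indicator_transform A (t - s)))\<^sup>2) \<partial>\<nu>) = ennreal a * emeasure M A"
    if [measurable]: "A \<in> sets borel" for A s
  proof -
    have "(\<integral>\<^sup>+ x. ennreal ((cmod (indicator A x * iexp (2 * pi * s * x)))\<^sup>2) \<partial>M)
        = (\<integral>\<^sup>+ x. indicator A x \<partial>M)"
      by (intro nn_integral_cong) (auto simp: norm_mult indicator_def)
    also have "\<dots> = emeasure M A" by simp
    finally show ?thesis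
      using a(2)[OF in_L2_modulated_indicator[OF that, of s]]
      unfolding fourier_meas_modulated_indicator by simp
  qed
  then show thesis using that a(1) by blast
qed

text \<open>The squared transform of the constant 1 is 1 at the origin and at least
  \<open>1/2\<close> near it. The translated frame identity therefore bounds the
  \<open>\<nu>\<close>-measure of every ball of a fixed radius, and countably many such balls cover
  the line.\<close>

lemma sigma_finite_tight_frame:
  assumes \<nu>: "tight_frame_measure M \<nu>"
  shows "sigma_finite_measure \<nu>"
proof -
  obtain a where a: "\<And>A s. A \<in> sets borel \<Longrightarrow>
      (\<integral>\<^sup>+t. ennreal ((cmod (indicator_transform A (t - s)))\<^sup>2) \<partial>\<nu>) = ennreal a * emeasure M A"
    using tight_frame_translated_transform[OF \<nu>] by metis
  have sets_\<nu>[measurable_cong]: "sets \<nu> = sets borel" using \<nu> by (simp add: tight_frame_measure_def)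
  have eq: "indicator_transform UNIV t = char M (- (2 * pi * t))" for t
    by (simp add: indicator_transform_def char_def)
  have "isCont (\<lambda>t. (cmod (char M t))\<^sup>2) 0"
    using isCont_char by (intro continuous_intros)
  then obtain e where e: "e > 0" "\<And>t. \<bar>t\<bar> < e \<Longrightarrow> \<bar>(cmod (char M t))\<^sup>2 - 1\<bar> < 1/2"
    unfolding continuous_at_real_range by (elim allE[of _ "1/2"]) (auto simp: char_zero)
  define r where "r = e / (2 * pi)"
  have r: "r > 0" using e by (simp add: r_def)
  define c :: real where "c = 1/2"
  have c: "0 < c" by (simp add: c_def)
  have big: "c \<le> (cmod (indicator_transform UNIV t))\<^sup>2" if "\<bar>t\<bar> < r" for t :: real
  proof -
    have "\<bar>- (2 * pi * t)\<bar> < e" using that by (simp add: r_def abs_mult field_simps)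
    then show ?thesis using e(2)[of "- (2 * pi * t)"] unfolding eq abs_less_iff c_def by linarith
  qed
  have fin: "emeasure \<nu> (ball q r) \<noteq> \<infinity>" for q
  proof -
    have "ennreal c * emeasure \<nu> (ball q r) = (\<integral>\<^sup>+t. ennreal c * indicator (ball q r) t \<partial>\<nu>)"
      by (subst nn_integral_cmult_indicator) (auto simp: sets_\<nu>)
    also have "\<dots> \<le> (\<integral>\<^sup>+t. ennreal ((cmod (indicator_transform UNIV (t - q)))\<^sup>2) \<partial>\<nu>)"
      using big by (intro nn_integral_mono) (auto simp: indicator_def dist_real_def abs_minus_commute intro!: ennreal_leI)
    also have "\<dots> < \<infinity>"
      using a[of UNIV q] emeasure_space_1 by (simp add: ennreal_mult_less_top)
    finally have "ennreal c * emeasure \<nu> (ball q r) < \<infinity>" .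
    then show ?thesis using c by (auto simp: ennreal_mult_less_top)
  qed
  have "(\<Union>q\<in>\<rat>. ball q r) = (UNIV :: real set)"
  proof -
    have "\<exists>q\<in>\<rat>. x \<in> ball q r" for x :: real
    proof -
      obtain q where "q \<in> \<rat>" "x - r < q" "q < x + r" using Rats_dense_in_real[of "x - r" "x + r"] r by auto
      then show ?thesis by (intro bexI[of _ q]) (auto simp: dist_real_def)
    qed
    then show ?thesis by blast
  qed
  moreover have "space \<nu> = UNIV" using sets_eq_imp_space_eq[OF sets_\<nu>] by simp
  ultimately show ?thesis
    using fin countable_rat
    by (intro sigma_finite_measure.intro exI[of _ "(\<lambda>q. ball q r) ` \<rat>"]) (auto simp: sets_\<nu>)
qed

text \<open>Integrating the convolution of the two squared transforms against the frame measure in both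
  orders shows that Lebesgue measure is itself a tight frame measure, up to a constant.\<close>

lemma energy_proportional:
  assumes \<nu>: "tight_frame_measure M \<nu>" and [measurable]: "A \<in> sets borel" "B \<in> sets borel"
  shows "emeasure M A * energy B = emeasure M B * energy A"
proof -
  obtain a where a: "0 < a" "\<And>A s. A \<in> sets borel \<Longrightarrow>
      (\<integral>\<^sup>+t. ennreal ((cmod (indicator_transform A (t - s)))\<^sup>2) \<partial>\<nu>) = ennreal a * emeasure M A"
    using tight_frame_translated_transform[OF \<nu>] by metis
  have sets_\<nu>[measurable_cong]: "sets \<nu> = sets borel" using \<nu> by (simp add: tight_frame_measure_def)
  interpret \<nu>: sigma_finite_measure \<nu> by (rule sigma_finite_tight_frame[OF \<nu>])
  interpret pair: pair_sigma_finite \<nu> lborel ..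
  let ?f = "\<lambda>A t. ennreal ((cmod (indicator_transform A t))\<^sup>2)"
  have one: "(\<integral>\<^sup>+t. \<integral>\<^sup>+s. ?f A (t - s) * ?f B s \<partial>lborel \<partial>\<nu>) = ennreal a * (emeasure M A * energy B)"
    if [measurable]: "A \<in> sets borel" "B \<in> sets borel" for A B
  proof -
    have "(\<integral>\<^sup>+t. \<integral>\<^sup>+s. ?f A (t - s) * ?f B s \<partial>lborel \<partial>\<nu>) = (\<integral>\<^sup>+s. \<integral>\<^sup>+t. ?f A (t - s) * ?f B s \<partial>\<nu> \<partial>lborel)"
      by (intro pair.Fubini'[symmetric]) measurable
    also have "\<dots> = (\<integral>\<^sup>+s. ennreal a * emeasure M A * ?f B s \<partial>lborel)"
    proof (rule nn_integral_cong)
      fix s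
      have "(\<integral>\<^sup>+t. ?f A (t - s) * ?f B s \<partial>\<nu>) = (\<integral>\<^sup>+t. ?f A (t - s) \<partial>\<nu>) * ?f B s"
        by (rule nn_integral_multc) measurable
      then show "(\<integral>\<^sup>+t. ?f A (t - s) * ?f B s \<partial>\<nu>) = ennreal a * emeasure M A * ?f B s"
        using a(2)[of A s] by simp
    qed
    also have "\<dots> = ennreal a * (emeasure M A * energy B)"
      unfolding energy_def by (subst nn_integral_cmult) (auto simp: mult.assoc)
    finally show ?thesis .
  qed
  \<comment> \<open>The substitution of \<open>t - s\<close> for \<open>s\<close>: convolution is
    symmetric in \<open>A\<close> and \<open>B\<close>, while the frame identity evaluates it
    asymmetrically.\<close>
  have "(\<integral>\<^sup>+s. ?f A (t - s) * ?f B s \<partial>lborel) = (\<integral>\<^sup>+s. ?f B (t - s) * ?f A s \<partial>lborel)" for t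
    using nn_integral_real_affine[of "\<lambda>s. ?f A (t - s) * ?f B s" "- 1" t] by (simp add: mult.commute)
  then have "ennreal a * (emeasure M A * energy B) = ennreal a * (emeasure M B * energy A)"
    using one[of A B] one[of B A] by simp
  then show ?thesis using a(1) by (subst (asm) ennreal_mult_cancel_left) auto
qed

lemma cmod_indicator_transform_sq:
  assumes [measurable]: "A \<in> sets borel"
  shows "complex_of_real ((cmod (indicator_transform A t))\<^sup>2)
    = (CLINT x|M. CLINT y|M. indicator A x * indicator A y * iexp (- (2 * pi * t) * (x - y)))"
proof -
  have "complex_of_real ((cmod (indicator_transform A t))\<^sup>2)
      = indicator_transform A t * cnj (indicator_transform A t)"
    by (rule complex_norm_square)
  also have "cnj (indicator_transform A t) = (CLINT y|M. cnj (indicator A y * iexp (- (2 * pi * t) * y)))"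
    unfolding indicator_transform_def by (rule Bochner_Integration.integral_cnj[symmetric])
  also have "\<dots> = (CLINT y|M. indicator A y * iexp ((2 * pi * t) * y))"
    by (intro Bochner_Integration.integral_cong refl) (simp add: exp_cnj indicator_def)
  also have "indicator_transform A t * \<dots>
      = (CLINT x|M. CLINT y|M. indicator A x * iexp (- (2 * pi * t) * x) * (indicator A y * iexp ((2 * pi * t) * y)))"
    unfolding indicator_transform_def by simp
  also have "\<dots> = (CLINT x|M. CLINT y|M. indicator A x * indicator A y * iexp (- (2 * pi * t) * (x - y)))"
    by (intro Bochner_Integration.integral_cong refl) (simp add: indicator_def exp_add[symmetric] algebra_simps)
  finally show ?thesis .
qed

text \<open>Write the squared modulus as a double integral and average over \<open>s\<close>
  innermost: this produces the characteristic function of the normal distribution, again a Gaussian.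
  All integrands are bounded by 1 on probability spaces, which justifies the exchanges.\<close>

lemma std_normal_average_transform:
  assumes [measurable]: "A \<in> sets borel"
  shows "(\<integral>\<^sup>+s. ennreal ((cmod (indicator_transform A (r * s)))\<^sup>2) \<partial>std_normal_distribution)
    = (\<integral>\<^sup>+x. \<integral>\<^sup>+y. indicator A x * indicator A y * ennreal (exp (- (2 * pi * r * (x - y))\<^sup>2 / 2)) \<partial>M \<partial>M)"
proof -
  let ?\<gamma> = "std_normal_distribution"
  interpret \<gamma>: real_distribution ?\<gamma> by (rule real_dist_normal_dist)
  interpret \<gamma>M: pair_prob_space ?\<gamma> M ..
  have le1: "cmod (indicator_transform A t) \<le> 1" for t
  proof -
    have "cmod (indicator_transform A t) \<le> (\<integral>x. cmod (indicator A x * iexp (- (2 * pi * t) * x)) \<partial>M)"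
      unfolding indicator_transform_def by (intro integral_norm_bound)
    also have "\<dots> \<le> (\<integral>x. 1 \<partial>M)"
      by (intro integral_mono integrable_const_bound[where B = 1]) (auto simp: norm_mult indicator_def)
    finally show ?thesis using prob_space by simp
  qed
  let ?H = "\<lambda>s x y. indicator A x * indicator A y * iexp (- (2 * pi * (r * s)) * (x - y)) :: complex"
  have H1: "cmod (?H s x y) \<le> 1" for s x y by (auto simp: norm_mult indicator_def)
  have meas_H[measurable]: "(\<lambda>(s, x, y). ?H s x y) \<in> borel_measurable (borel \<Otimes>\<^sub>M borel \<Otimes>\<^sub>M borel)"
    by measurable
  have int_y: "cmod (CLINT y|M. ?H s x y) \<le> 1" for s x
  proof -
    have "cmod (CLINT y|M. ?H s x y) \<le> (\<integral>y. cmod (?H s x y) \<partial>M)" by (intro integral_norm_bound)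
    also have "\<dots> \<le> (\<integral>y. 1 \<partial>M)"
      using H1 by (intro integral_mono integrable_const_bound[where B = 1]) auto
    finally show ?thesis using prob_space by simp
  qed
  have "complex_of_real (\<integral>s. (cmod (indicator_transform A (r * s)))\<^sup>2 \<partial>?\<gamma>)
      = (CLINT s|?\<gamma>. CLINT x|M. CLINT y|M. ?H s x y)"
    by (simp add: integral_complex_of_real[symmetric] cmod_indicator_transform_sq del: of_real_power integral_complex_of_real)
  also have "\<dots> = (CLINT x|M. CLINT s|?\<gamma>. CLINT y|M. ?H s x y)"
  proof (rule \<gamma>M.Fubini_integral[symmetric])
    show "integrable (?\<gamma> \<Otimes>\<^sub>M M) (\<lambda>(s, x). CLINT y|M. ?H s x y)"
      using int_y by (intro \<gamma>M.integrable_const_bound[where B = 1]) (auto simp: split_beta)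
  qed
  also have "\<dots> = (CLINT x|M. CLINT y|M. CLINT s|?\<gamma>. ?H s x y)"
  proof (rule Bochner_Integration.integral_cong[OF refl], rule \<gamma>M.Fubini_integral[symmetric])
    fix x
    show "integrable (?\<gamma> \<Otimes>\<^sub>M M) (\<lambda>(s, y). ?H s x y)"
      using H1 by (intro \<gamma>M.integrable_const_bound[where B = 1]) (auto simp: split_beta)
  qed
  also have "\<dots> = (CLINT x|M. CLINT y|M. complex_of_real (indicator A x * indicator A y * exp (- (2 * pi * r * (x - y))\<^sup>2 / 2)))"
  proof (intro Bochner_Integration.integral_cong refl)
    fix x y
    have "(CLINT s|?\<gamma>. ?H s x y) = indicator A x * indicator A y * (CLINT s|?\<gamma>. iexp ((- (2 * pi * r * (x - y))) * s))"
      by (simp add: algebra_simps)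
    also have "(CLINT s|?\<gamma>. iexp ((- (2 * pi * r * (x - y))) * s)) = char ?\<gamma> (- (2 * pi * r * (x - y)))"
      by (simp only: char_def)
    also have "\<dots> = complex_of_real (exp (- (2 * pi * r * (x - y))\<^sup>2 / 2))"
      unfolding char_std_normal_distribution by simp
    finally show "(CLINT s|?\<gamma>. ?H s x y) = complex_of_real (indicator A x * indicator A y * exp (- (2 * pi * r * (x - y))\<^sup>2 / 2))"
      by (simp add: indicator_def)
  qed
  also have "\<dots> = complex_of_real (\<integral>x. \<integral>y. indicator A x * indicator A y * exp (- (2 * pi * r * (x - y))\<^sup>2 / 2) \<partial>M \<partial>M)"
    by (simp only: integral_complex_of_real)
  finally have eq: "(\<integral>s. (cmod (indicator_transform A (r * s)))\<^sup>2 \<partial>?\<gamma>)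
      = (\<integral>x. \<integral>y. indicator A x * indicator A y * exp (- (2 * pi * r * (x - y))\<^sup>2 / 2) \<partial>M \<partial>M)"
    by (simp only: of_real_eq_iff)
  let ?k = "\<lambda>x y. indicator A x * indicator A y * exp (- (2 * pi * r * (x - y))\<^sup>2 / 2) :: real"
  have k: "0 \<le> ?k x y" "?k x y \<le> 1" for x y by (auto simp: indicator_def)
  have int_k: "0 \<le> (\<integral>y. ?k x y \<partial>M)" "(\<integral>y. ?k x y \<partial>M) \<le> 1" for x
  proof -
    show "0 \<le> (\<integral>y. ?k x y \<partial>M)" using k by (intro integral_nonneg_AE) auto
    have "(\<integral>y. ?k x y \<partial>M) \<le> (\<integral>y. 1 \<partial>M)"
      using k by (intro integral_mono integrable_const_bound[where B = 1]) auto
    then show "(\<integral>y. ?k x y \<partial>M) \<le> 1" using prob_space by simp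
  qed
  have "(\<integral>\<^sup>+s. ennreal ((cmod (indicator_transform A (r * s)))\<^sup>2) \<partial>?\<gamma>) = ennreal (\<integral>s. (cmod (indicator_transform A (r * s)))\<^sup>2 \<partial>?\<gamma>)"
    using le1 by (intro nn_integral_eq_integral \<gamma>.integrable_const_bound[where B = 1]) (auto simp: power_le_one)
  also have "\<dots> = (\<integral>\<^sup>+x. ennreal (\<integral>y. ?k x y \<partial>M) \<partial>M)"
    unfolding eq using int_k by (intro nn_integral_eq_integral[symmetric] integrable_const_bound[where B = 1]) auto
  also have "\<dots> = (\<integral>\<^sup>+x. \<integral>\<^sup>+y. ennreal (?k x y) \<partial>M \<partial>M)"
    using k by (intro nn_integral_cong nn_integral_eq_integral[symmetric] integrable_const_bound[where B = 1]) auto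
  also have "\<dots> = (\<integral>\<^sup>+x. \<integral>\<^sup>+y. indicator A x * indicator A y * ennreal (exp (- (2 * pi * r * (x - y))\<^sup>2 / 2)) \<partial>M \<partial>M)"
    by (intro nn_integral_cong) (auto simp: indicator_def)
  finally show ?thesis .
qed

end

section \<open>Self-overlap of bounded sets and Gaussian kernels\<close>

text \<open>Squeeze a compact \<open>T\<close> inside \<open>A\<close> and an open \<open>U\<close>
  around \<open>T\<close>, each losing less than \<open>e/2\<close>. For small \<open>u\<close> both
  \<open>T\<close> and its translate lie in \<open>U\<close>, which is too small unless they overlap
  in almost all of \<open>T\<close>.\<close>

lemma self_overlap_near_zero:
  fixes A :: "real set"
  assumes A: "A \<in> sets borel" "bounded A" and e: "0 < e"
  shows "\<exists>\<rho>>0. \<forall>u. \<bar>u\<bar> < \<rho> \<longrightarrow> measure lebesgue A - e \<le> measure lebesgue (A \<inter> {x. x - u \<in> A})"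
proof -
  let ?m = "measure lebesgue"
  have A_leb: "A \<in> sets lebesgue" using A(1) by simp
  have lmA: "A \<in> lmeasurable" using A_leb A(2) by (rule bounded_set_imp_lmeasurable[rotated])
  obtain T where T: "closed T" "T \<subseteq> A" "A - T \<in> lmeasurable" "emeasure lebesgue (A - T) < ennreal (e/2)"
    using sets_lebesgue_inner_closed[OF A_leb, of "e/2"] e by auto
  have comp: "compact T" using T(1,2) A(2) bounded_subset compact_eq_bounded_closed by blast
  have lmT: "T \<in> lmeasurable" using comp by (rule lmeasurable_compact)
  have "?m (A - T) < e/2" using T(3,4) by (simp add: emeasure_eq_measure2 ennreal_less_iff)
  then have AT: "?m A < ?m T + e/2"
    using lmA lmT T(2) by (subst (asm) measurable_measure_Diff) (auto intro: fmeasurableD)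
  obtain U where U: "open U" "T \<subseteq> U" "U - T \<in> lmeasurable" "emeasure lebesgue (U - T) < ennreal (e/2)"
    using sets_lebesgue_outer_open[of T "e/2"] lmT e by (auto intro: fmeasurableD)
  have lmU: "U \<in> lmeasurable" using fmeasurable.Un[OF U(3) lmT] U(2) by (simp add: Un_absorb2)
  have "?m (U - T) < e/2" using U(3,4) by (simp add: emeasure_eq_measure2 ennreal_less_iff)
  then have UT: "?m U < ?m T + e/2"
    using lmU lmT U(2) by (subst (asm) measurable_measure_Diff) (auto intro: fmeasurableD)
  obtain \<rho> where \<rho>: "\<rho> > 0" "(\<Union>x\<in>T. ball x \<rho>) \<subseteq> U"
    using compact_subset_open_imp_ball_epsilon_subset[OF comp U(1,2)] .
  have "?m A - e \<le> ?m (A \<inter> {x. x - u \<in> A})" if u: "\<bar>u\<bar> < \<rho>" for u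
  proof -
    let ?Tu = "(+) u ` T"
    have lmTu: "?Tu \<in> lmeasurable" using lmT by (rule measurable_translation)
    have "?Tu \<subseteq> U" using \<rho>(2) u by (fastforce simp: dist_real_def)
    then have "?m (T \<union> ?Tu) \<le> ?m U"
      using U(2) lmT lmTu lmU by (intro measure_mono_fmeasurable) (auto intro: fmeasurableD)
    moreover have "?m (T \<union> ?Tu) = ?m T + ?m ?Tu - ?m (T \<inter> ?Tu)"
      using lmT lmTu by (rule measure_Un3)
    moreover have "?m ?Tu = ?m T" by (rule measure_translation)
    moreover have "?m (T \<inter> ?Tu) \<le> ?m (A \<inter> {x. x - u \<in> A})"
    proof (rule measure_mono_fmeasurable)
      show "T \<inter> ?Tu \<subseteq> A \<inter> {x. x - u \<in> A}" using T(2) by auto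
      show "T \<inter> ?Tu \<in> sets lebesgue" using lmT lmTu by (auto intro: fmeasurableD)
      have "{x. x - u \<in> A} = (\<lambda>x. x - u) -` A \<inter> space borel" by auto
      also have "\<dots> \<in> sets borel" using A(1) by measurable
      finally have "{x. x - u \<in> A} \<in> sets lebesgue" by simp
      then show "A \<inter> {x. x - u \<in> A} \<in> lmeasurable" using lmA by (simp add: fmeasurable_Int_fmeasurable)
    qed
    ultimately show ?thesis using AT UT by linarith
  qed
  then show ?thesis using \<rho>(1) by blast
qed

lemma emeasure_le_liminf_self_overlap:
  fixes A :: "real set"
  assumes A[measurable]: "A \<in> sets borel" "bounded A" and X: "X \<longlonglongrightarrow> 0"
  shows "emeasure lborel A \<le> liminf (\<lambda>n. \<integral>\<^sup>+x. indicator A x * indicator A (x - X n) \<partial>lborel)"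
  unfolding le_Liminf_iff
proof (intro allI impI)
  fix y assume y: "y < emeasure lborel A"
  have lmA: "A \<in> lmeasurable" using A by (intro bounded_set_imp_lmeasurable) auto
  have emA: "emeasure lborel S = ennreal (measure lebesgue S)" if "S \<subseteq> A" "S \<in> sets borel" for S
  proof -
    have "S \<in> lmeasurable" using that A(2) by (intro bounded_set_imp_lmeasurable) (auto intro: bounded_subset)
    then have "emeasure lebesgue S = ennreal (measure lebesgue S)" by (simp add: emeasure_eq_measure2)
    moreover have "emeasure lebesgue S = emeasure lborel S" using that(2) by simp
    ultimately show ?thesis by simp
  qed
  have "y < ennreal (measure lebesgue A)" using y emA[of A] by simp
  then obtain y' where y': "0 \<le> y'" "y = ennreal y'" "y' < measure lebesgue A"
    by (cases y) (auto simp: ennreal_less_iff)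
  define e where "e = (measure lebesgue A - y') / 2"
  have e: "0 < e" "y' < measure lebesgue A - e" using y'(3) by (auto simp: e_def field_simps)
  obtain \<rho> where \<rho>: "\<rho> > 0" "\<forall>u. \<bar>u\<bar> < \<rho> \<longrightarrow> measure lebesgue A - e \<le> measure lebesgue (A \<inter> {x. x - u \<in> A})"
    using self_overlap_near_zero[OF A e(1)] by blast
  have "eventually (\<lambda>n. \<bar>X n\<bar> < \<rho>) sequentially"
    using X \<rho>(1) by (simp add: tendsto_iff dist_real_def)
  then show "eventually (\<lambda>n. y < (\<integral>\<^sup>+x. indicator A x * indicator A (x - X n) \<partial>lborel)) sequentially"
  proof (rule eventually_mono)
    fix n assume n: "\<bar>X n\<bar> < \<rho>"
    let ?S = "A \<inter> {x. x - X n \<in> A}"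
    have "{x. x - X n \<in> A} = (\<lambda>x. x - X n) -` A \<inter> space borel" by auto
    also have "\<dots> \<in> sets borel" by measurable
    finally have S: "?S \<in> sets borel" by auto
    have "(\<integral>\<^sup>+x. indicator A x * indicator A (x - X n) \<partial>lborel) = (\<integral>\<^sup>+x. indicator ?S x \<partial>lborel)"
      by (intro nn_integral_cong) (auto simp: indicator_def)
    also have "\<dots> = ennreal (measure lebesgue ?S)" using S by (simp add: emA)
    finally show "y < (\<integral>\<^sup>+x. indicator A x * indicator A (x - X n) \<partial>lborel)"
      using \<rho>(2) n e(2) y' by (auto simp: ennreal_less_iff intro: less_le_trans)
  qed
qed

lemma nn_integral_normal_density: "0 < \<sigma> \<Longrightarrow> (\<integral>\<^sup>+x. ennreal (normal_density \<mu> \<sigma> x) \<partial>lborel) = 1"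
  by (subst nn_integral_eq_integral) auto

lemma normal_density_commute: "normal_density y \<sigma> x = normal_density x \<sigma> y"
  by (simp add: normal_density_def power2_commute)

lemma borel_measurable_normal_density_mean [measurable]:
  assumes [measurable]: "f \<in> borel_measurable M" "g \<in> borel_measurable M"
  shows "(\<lambda>x. normal_density (f x) \<sigma> (g x)) \<in> borel_measurable M"
  unfolding normal_density_def by measurable

text \<open>The substitution \<open>y = x - \<sigma> * s\<close> turns the Gaussian kernel into a
  normal average of self-overlaps, ready for the limit of small \<open>\<sigma>\<close>.\<close>

lemma nn_integral_normal_pair:
  fixes A :: "real set"
  assumes [measurable]: "A \<in> sets borel" and \<sigma>: "0 < \<sigma>"
  shows "(\<integral>\<^sup>+x. \<integral>\<^sup>+y. indicator A x * indicator A y * ennreal (normal_density y \<sigma> x) \<partial>lborel \<partial>lborel)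
    = (\<integral>\<^sup>+s. (\<integral>\<^sup>+x. indicator A x * indicator A (x - \<sigma> * s) \<partial>lborel) \<partial>std_normal_distribution)"
proof -
  have scale: "ennreal \<sigma> * ennreal (normal_density (x - \<sigma> * s) \<sigma> x) = ennreal (std_normal_density s)" for x s
    using \<sigma> by (simp add: ennreal_mult[symmetric] normal_density_def power_mult_distrib real_sqrt_mult)
  have "(\<integral>\<^sup>+y. indicator A x * indicator A y * ennreal (normal_density y \<sigma> x) \<partial>lborel)
      = (\<integral>\<^sup>+s. indicator A x * indicator A (x - \<sigma> * s) * ennreal (std_normal_density s) \<partial>lborel)" for x
  proof -
    have "(\<integral>\<^sup>+y. indicator A x * indicator A y * ennreal (normal_density y \<sigma> x) \<partial>lborel)
        = ennreal \<sigma> * (\<integral>\<^sup>+s. indicator A x * indicator A (x - \<sigma> * s) * ennreal (normal_density (x - \<sigma> * s) \<sigma> x) \<partial>lborel)"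
      using \<sigma> by (subst nn_integral_real_affine[where c = "- \<sigma>" and t = x]) auto
    also have "\<dots> = (\<integral>\<^sup>+s. ennreal \<sigma> * (indicator A x * indicator A (x - \<sigma> * s) * ennreal (normal_density (x - \<sigma> * s) \<sigma> x)) \<partial>lborel)"
      by (subst nn_integral_cmult) auto
    also have "\<dots> = (\<integral>\<^sup>+s. indicator A x * indicator A (x - \<sigma> * s) * ennreal (std_normal_density s) \<partial>lborel)"
      by (intro nn_integral_cong) (simp only: mult.left_commute[of "ennreal \<sigma>"] scale)
    finally show ?thesis .
  qed
  then have "(\<integral>\<^sup>+x. \<integral>\<^sup>+y. indicator A x * indicator A y * ennreal (normal_density y \<sigma> x) \<partial>lborel \<partial>lborel)
      = (\<integral>\<^sup>+x. \<integral>\<^sup>+s. indicator A x * indicator A (x - \<sigma> * s) * ennreal (std_normal_density s) \<partial>lborel \<partial>lborel)"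
    by simp
  also have "\<dots> = (\<integral>\<^sup>+s. \<integral>\<^sup>+x. indicator A x * indicator A (x - \<sigma> * s) * ennreal (std_normal_density s) \<partial>lborel \<partial>lborel)"
    by (rule lborel_pair.Fubini'[symmetric]) measurable
  also have "\<dots> = (\<integral>\<^sup>+s. ennreal (std_normal_density s) * (\<integral>\<^sup>+x. indicator A x * indicator A (x - \<sigma> * s) \<partial>lborel) \<partial>lborel)"
    by (intro nn_integral_cong, subst nn_integral_multc) (auto simp: mult.commute)
  also have "\<dots> = (\<integral>\<^sup>+s. (\<integral>\<^sup>+x. indicator A x * indicator A (x - \<sigma> * s) \<partial>lborel) \<partial>std_normal_distribution)"
    by (subst nn_integral_density) auto
  finally show ?thesis .
qed

section \<open>Damped energies and their bounds in terms of the density\<close>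

context real_distribution
begin

text \<open>The energy with a Gaussian cut-off in frequency, rewritten as a double integral in
  space; \<open>\<sigma>\<close> is inversely proportional to the cut-off
  (\<open>nn_integral_Gaussian_damped_transform\<close>).\<close>

definition damped_energy :: "real \<Rightarrow> real set \<Rightarrow> ennreal" where
  "damped_energy \<sigma> A = (\<integral>\<^sup>+x. \<integral>\<^sup>+y. indicator A x * indicator A y * ennreal (normal_density y \<sigma> x) \<partial>M \<partial>M)"

lemma nn_integral_Gaussian_damped_transform:
  assumes [measurable]: "A \<in> sets borel" and r: "0 < r"
  shows "(\<integral>\<^sup>+s. ennreal ((cmod (indicator_transform A s))\<^sup>2) * ennreal (exp (- (s / r)\<^sup>2 / 2)) \<partial>lborel)
    = damped_energy (1 / (2 * pi * r)) A"
proof -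
  let ?\<Phi> = "\<lambda>s. ennreal ((cmod (indicator_transform A s))\<^sup>2)"
  \<comment> \<open>The peak value of the normal density with deviation
    \<open>1 / (2 * pi * r)\<close>; it collects the factors from rescaling and normalising.\<close>
  define c where "c = r * sqrt (2 * pi)"
  have c: "0 < c" using r by (simp add: c_def)
  have exp_eq: "ennreal (exp (- s\<^sup>2 / 2)) = ennreal (sqrt (2 * pi)) * ennreal (std_normal_density s)" for s
    by (simp add: std_normal_density_def ennreal_mult[symmetric])
  have "(\<integral>\<^sup>+s. ?\<Phi> s * ennreal (exp (- (s / r)\<^sup>2 / 2)) \<partial>lborel)
      = ennreal r * (\<integral>\<^sup>+s. ?\<Phi> (r * s) * ennreal (exp (- s\<^sup>2 / 2)) \<partial>lborel)"
    using r by (subst nn_integral_real_affine[where c = r and t = 0]) auto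
  also have "\<dots> = ennreal r * (\<integral>\<^sup>+s. ennreal (sqrt (2 * pi)) * (ennreal (std_normal_density s) * ?\<Phi> (r * s)) \<partial>lborel)"
    by (simp only: exp_eq mult_ac)
  also have "\<dots> = ennreal c * (\<integral>\<^sup>+s. ennreal (std_normal_density s) * ?\<Phi> (r * s) \<partial>lborel)"
    using r by (subst nn_integral_cmult) (auto simp: c_def ennreal_mult mult.assoc)
  also have "(\<integral>\<^sup>+s. ennreal (std_normal_density s) * ?\<Phi> (r * s) \<partial>lborel) = (\<integral>\<^sup>+s. ?\<Phi> (r * s) \<partial>std_normal_distribution)"
    by (subst nn_integral_density) auto
  also have "\<dots> = (\<integral>\<^sup>+x. \<integral>\<^sup>+y. indicator A x * indicator A y * ennreal (exp (- (2 * pi * r * (x - y))\<^sup>2 / 2)) \<partial>M \<partial>M)"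
    by (rule std_normal_average_transform) simp
  also have "ennreal c * \<dots> = (\<integral>\<^sup>+x. \<integral>\<^sup>+y. ennreal c * (indicator A x * indicator A y * ennreal (exp (- (2 * pi * r * (x - y))\<^sup>2 / 2))) \<partial>M \<partial>M)"
    by (simp add: nn_integral_cmult)
  also have "\<dots> = damped_energy (1 / (2 * pi * r)) A"
    unfolding damped_energy_def
  proof (intro nn_integral_cong)
    fix x y
    have "sqrt (2 * pi * (1 / (2 * pi * r))\<^sup>2) = 1 / c"
      using r by (simp add: c_def real_sqrt_mult real_sqrt_divide power2_eq_square field_simps)
    moreover have "- z\<^sup>2 / (2 * (1 / (2 * pi * r))\<^sup>2) = - (2 * pi * r * z)\<^sup>2 / 2" for z
      using r by (simp add: power_mult_distrib power_divide field_simps)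
    ultimately have "normal_density y (1 / (2 * pi * r)) x = c * exp (- (2 * pi * r * (x - y))\<^sup>2 / 2)"
      unfolding normal_density_def by simp
    then show "ennreal c * (indicator A x * indicator A y * ennreal (exp (- (2 * pi * r * (x - y))\<^sup>2 / 2)))
        = indicator A x * indicator A y * ennreal (normal_density y (1 / (2 * pi * r)) x)"
      using c by (simp add: ennreal_mult mult_ac)
  qed
  finally show ?thesis .
qed

lemma damped_energy_le:
  assumes [measurable]: "A \<in> sets borel" and r: "0 < r"
  shows "damped_energy (1 / (2 * pi * r)) A \<le> energy A"
  unfolding nn_integral_Gaussian_damped_transform[OF assms, symmetric] energy_def
proof (rule nn_integral_mono)
  fix s
  have "ennreal (exp (- (s / r)\<^sup>2 / 2)) \<le> 1" by simp
  then show "ennreal ((cmod (indicator_transform A s))\<^sup>2) * ennreal (exp (- (s / r)\<^sup>2 / 2))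
      \<le> ennreal ((cmod (indicator_transform A s))\<^sup>2)"
    using mult_left_mono[of "ennreal (exp (- (s / r)\<^sup>2 / 2))" 1 "ennreal ((cmod (indicator_transform A s))\<^sup>2)"] by simp
qed

lemma energy_eq_SUP_damped:
  assumes [measurable]: "A \<in> sets borel"
  shows "energy A = (SUP n. damped_energy (1 / (2 * pi * real (Suc n))) A)"
proof -
  let ?\<Phi> = "\<lambda>s. ennreal ((cmod (indicator_transform A s))\<^sup>2)"
  let ?f = "\<lambda>n s. ?\<Phi> s * ennreal (exp (- (s / real (Suc n))\<^sup>2 / 2))"
  have mono: "incseq ?f"
  proof (intro incseq_SucI le_funI mult_left_mono ennreal_leI)
    fix n s
    have "\<bar>s\<bar> / real (Suc (Suc n)) \<le> \<bar>s\<bar> / real (Suc n)" by (intro divide_left_mono) auto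
    then have "(\<bar>s\<bar> / real (Suc (Suc n)))\<^sup>2 \<le> (\<bar>s\<bar> / real (Suc n))\<^sup>2" by (intro power_mono) auto
    then show "exp (- (s / real (Suc n))\<^sup>2 / 2) \<le> exp (- (s / real (Suc (Suc n)))\<^sup>2 / 2)"
      by (simp add: power_divide)
  qed auto
  have lim: "(\<lambda>n. ?f n s) \<longlonglongrightarrow> ?\<Phi> s" for s
  proof -
    have "(\<lambda>n. exp (- (s / real (Suc n))\<^sup>2 / 2)) \<longlonglongrightarrow> exp (- 0\<^sup>2 / 2)"
      by (intro tendsto_intros LIMSEQ_Suc[OF lim_const_over_n]) simp
    then have "(\<lambda>n. ennreal ((cmod (indicator_transform A s))\<^sup>2 * exp (- (s / real (Suc n))\<^sup>2 / 2)))
        \<longlonglongrightarrow> ennreal ((cmod (indicator_transform A s))\<^sup>2 * 1)"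
      by (intro tendsto_ennrealI tendsto_mult tendsto_const) simp
    then show ?thesis by (simp add: ennreal_mult)
  qed
  have "energy A = (\<integral>\<^sup>+s. (SUP n. ?f n s) \<partial>lborel)"
    unfolding energy_def
  proof (intro nn_integral_cong)
    fix s
    have "incseq (\<lambda>n. ?f n s)" using mono by (auto simp: incseq_def le_fun_def)
    then show "?\<Phi> s = (SUP n. ?f n s)" using LIMSEQ_SUP lim LIMSEQ_unique by blast
  qed
  also have "\<dots> = (SUP n. integral\<^sup>N lborel (?f n))"
    using mono by (intro nn_integral_monotone_convergence_SUP) auto
  finally show ?thesis by (simp only: nn_integral_Gaussian_damped_transform[OF assms] of_nat_0_less_iff zero_less_Suc)
qed

text \<open>Only the inner copy of the density is replaced by its bound \<open>m\<close>; the kernel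
  then integrates to at most 1 and the outer integral leaves \<open>emeasure M A\<close>.\<close>

lemma energy_le_if_density_le:
  assumes [measurable]: "g \<in> borel_measurable borel" "A \<in> sets borel"
    and M: "M = density lborel g" and le: "\<And>x. x \<in> A \<Longrightarrow> g x \<le> m"
  shows "energy A \<le> m * emeasure M A"
  unfolding energy_eq_SUP_damped[OF assms(2)]
proof (rule SUP_least)
  fix n
  define \<sigma> where "\<sigma> = 1 / (2 * pi * real (Suc n))"
  have \<sigma>: "0 < \<sigma>" by (simp add: \<sigma>_def)
  have "(\<integral>\<^sup>+y. indicator A x * indicator A y * ennreal (normal_density y \<sigma> x) \<partial>M) \<le> m * indicator A x" for x
  proof -
    have "(\<integral>\<^sup>+y. indicator A x * indicator A y * ennreal (normal_density y \<sigma> x) \<partial>M)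
        = (\<integral>\<^sup>+y. g y * (indicator A x * indicator A y * ennreal (normal_density y \<sigma> x)) \<partial>lborel)"
      unfolding M by (subst nn_integral_density) auto
    also have "\<dots> \<le> (\<integral>\<^sup>+y. (m * indicator A x) * ennreal (normal_density x \<sigma> y) \<partial>lborel)"
      using le by (intro nn_integral_mono) (auto simp: indicator_def normal_density_commute[of _ \<sigma> x] intro!: mult_right_mono)
    also have "\<dots> = m * indicator A x"
      using nn_integral_normal_density[OF \<sigma>] by (subst nn_integral_cmult) auto
    finally show ?thesis .
  qed
  then have "damped_energy \<sigma> A \<le> (\<integral>\<^sup>+x. m * indicator A x \<partial>M)"
    unfolding damped_energy_def by (intro nn_integral_mono) auto
  also have "\<dots> = m * emeasure M A" by (subst nn_integral_cmult_indicator) auto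
  finally show "damped_energy (1 / (2 * pi * real (Suc n))) A \<le> m * emeasure M A" by (simp add: \<sigma>_def)
qed

text \<open>Both copies of the density are replaced by \<open>m\<close>. What remains is a normal
  average of self-overlaps, and Fatou's lemma recovers the Lebesgue measure of \<open>A\<close> as
  the width tends to 0.\<close>

lemma energy_ge_if_density_ge:
  assumes [measurable]: "g \<in> borel_measurable borel" "A \<in> sets borel"
    and M: "M = density lborel g" and A: "bounded A"
    and ge: "\<And>x. x \<in> A \<Longrightarrow> ennreal m \<le> g x" and m: "0 < m"
  shows "ennreal (m\<^sup>2) * emeasure lborel A \<le> energy A"
proof -
  define \<sigma> where "\<sigma> n = 1 / (2 * pi * real (Suc n))" for n
  have \<sigma>: "0 < \<sigma> n" for n by (simp add: \<sigma>_def)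
  have "(\<lambda>n. (1 / (2 * pi)) / real (Suc n)) \<longlonglongrightarrow> 0" by (intro LIMSEQ_Suc[OF lim_const_over_n])
  then have \<sigma>_lim: "\<sigma> \<longlonglongrightarrow> 0" by (simp add: \<sigma>_def[abs_def] field_simps)
  define \<phi> where "\<phi> u = (\<integral>\<^sup>+x. indicator A x * indicator A (x - u) \<partial>lborel)" for u :: real
  have [measurable]: "\<phi> \<in> borel_measurable borel" unfolding \<phi>_def by measurable
  let ?K = "\<lambda>n. \<integral>\<^sup>+s. \<phi> (\<sigma> n * s) \<partial>std_normal_distribution"
  interpret \<gamma>: real_distribution std_normal_distribution by (rule real_dist_normal_dist)
  have "ennreal (m\<^sup>2) * ?K n \<le> energy A" for n
  proof -
    let ?k = "\<lambda>x y. indicator A x * indicator A y * ennreal (normal_density y (\<sigma> n) x)"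
    have "?K n = (\<integral>\<^sup>+x. \<integral>\<^sup>+y. ?k x y \<partial>lborel \<partial>lborel)"
      by (simp only: \<phi>_def nn_integral_normal_pair[OF assms(2) \<sigma>])
    then have "ennreal (m\<^sup>2) * ?K n = ennreal m * (ennreal m * (\<integral>\<^sup>+x. \<integral>\<^sup>+y. ?k x y \<partial>lborel \<partial>lborel))"
      using m by (simp only: power2_eq_square ennreal_mult[OF less_imp_le[OF m] less_imp_le[OF m]] mult.assoc)
    also have "\<dots> = (\<integral>\<^sup>+x. \<integral>\<^sup>+y. ennreal m * (ennreal m * ?k x y) \<partial>lborel \<partial>lborel)"
      by (simp add: nn_integral_cmult)
    also have "\<dots> \<le> (\<integral>\<^sup>+x. \<integral>\<^sup>+y. g x * (g y * ?k x y) \<partial>lborel \<partial>lborel)"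
      using ge by (intro nn_integral_mono) (auto simp: indicator_def intro!: mult_mono)
    also have "\<dots> = damped_energy (\<sigma> n) A"
    proof -
      have dens: "integral\<^sup>N M f = (\<integral>\<^sup>+x. g x * f x \<partial>lborel)" if "f \<in> borel_measurable borel" for f
        using that by (subst M) (simp add: nn_integral_density)
      show ?thesis by (simp add: damped_energy_def dens nn_integral_cmult)
    qed
    also have "\<dots> \<le> energy A" unfolding \<sigma>_def by (intro damped_energy_le) auto
    finally show ?thesis .
  qed
  then have "ennreal (1 / m\<^sup>2) * (ennreal (m\<^sup>2) * ?K n) \<le> ennreal (1 / m\<^sup>2) * energy A" for n
    by (intro mult_left_mono) auto
  moreover have inv: "ennreal (1 / m\<^sup>2) * (ennreal (m\<^sup>2) * z) = z" "ennreal (m\<^sup>2) * (ennreal (1 / m\<^sup>2) * z) = z" for z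
    using m by (simp_all add: mult.assoc[symmetric] ennreal_mult[symmetric])
  ultimately have K_le: "?K n \<le> ennreal (1 / m\<^sup>2) * energy A" for n by simp
  have "emeasure lborel A = (\<integral>\<^sup>+s. emeasure lborel A \<partial>std_normal_distribution)"
    using \<gamma>.emeasure_space_1 by simp
  also have "\<dots> \<le> (\<integral>\<^sup>+s. liminf (\<lambda>n. \<phi> (\<sigma> n * s)) \<partial>std_normal_distribution)"
  proof (rule nn_integral_mono)
    fix s
    have "(\<lambda>n. \<sigma> n * s) \<longlonglongrightarrow> 0" using tendsto_mult_right[OF \<sigma>_lim, of s] by simp
    then show "emeasure lborel A \<le> liminf (\<lambda>n. \<phi> (\<sigma> n * s))"
      unfolding \<phi>_def using A by (intro emeasure_le_liminf_self_overlap) auto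
  qed
  also have "\<dots> \<le> liminf ?K" by (intro nn_integral_liminf) auto
  also have "\<dots> \<le> limsup ?K" by (intro Liminf_le_Limsup) auto
  also have "\<dots> \<le> ennreal (1 / m\<^sup>2) * energy A" using K_le by (intro Limsup_bounded) auto
  finally have "ennreal (m\<^sup>2) * emeasure lborel A \<le> ennreal (m\<^sup>2) * (ennreal (1 / m\<^sup>2) * energy A)"
    by (intro mult_left_mono) auto
  then show ?thesis by (simp only: inv)
qed

end

section \<open>Constancy of the density and of the weights\<close>

context real_distribution
begin

text \<open>Proportionality against \<open>UNIV\<close> says that the energy of \<open>A\<close> is
  \<open>energy UNIV\<close> times \<open>emeasure M A\<close>. The upper energy bound then excludes
  values of \<open>g\<close> strictly between 0 and that constant, and the lower bound excludes
  larger values.\<close>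

lemma tight_frame_density_const:
  assumes g[measurable]: "g \<in> borel_measurable borel" and M: "M = density lborel g"
    and \<nu>: "tight_frame_measure M \<nu>"
  shows "\<exists>c>0. AE x in lborel. g x = 0 \<or> g x = ennreal c"
proof -
  have energy_eq: "energy A = emeasure M A * energy UNIV" if "A \<in> sets borel" for A
    using energy_proportional[OF \<nu> that, of UNIV] emeasure_space_1 by simp
  have total: "(\<integral>\<^sup>+x. g x \<partial>lborel) = 1"
    using emeasure_space_1 by (simp add: M emeasure_density)
  have nonzero: "\<not> (AE x in lborel. g x = 0)"
    using total by (subst nn_integral_0_iff_AE[symmetric]) auto
  have finite_g: "AE x in lborel. g x \<noteq> \<infinity>"
    using total by (intro nn_integral_PInf_AE) auto
  have lower: "AE x in lborel. g x = 0 \<or> ennreal q < g x" if q: "ennreal q < energy UNIV" for q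
  proof -
    define B where "B = {x. 0 < g x \<and> g x \<le> ennreal q}"
    have [measurable]: "B \<in> sets borel" unfolding B_def by measurable
    have "energy B \<le> ennreal q * emeasure M B"
      by (rule energy_le_if_density_le[OF g _ M]) (simp_all add: B_def)
    then have "emeasure M B * energy UNIV \<le> emeasure M B * ennreal q"
      by (simp only: energy_eq[OF \<open>B \<in> sets borel\<close>] mult.commute[of "ennreal q"])
    then have "emeasure M B = 0"
    proof (rule contrapos_pp)
      assume "emeasure M B \<noteq> 0"
      then have "emeasure M B * energy UNIV \<le> emeasure M B * ennreal q \<longleftrightarrow> energy UNIV \<le> ennreal q"
        by (intro ennreal_mult_le_mult_iff) auto
      then show "\<not> emeasure M B * energy UNIV \<le> emeasure M B * ennreal q" using q by (simp add: not_le)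
    qed
    then have "B \<in> null_sets (density lborel g)" using M by (auto simp: null_sets_def)
    then have "AE x in lborel. x \<in> B \<longrightarrow> g x = 0" by (subst (asm) null_sets_density_iff) auto
    then show ?thesis by eventually_elim (auto simp: B_def not_le zero_less_iff_neq_zero)
  qed
  \<comment> \<open>With infinite total energy, \<open>lower\<close> would put every nonzero value
    of \<open>g\<close> above all integers.\<close>
  have "energy UNIV \<noteq> \<infinity>"
  proof
    assume "energy UNIV = \<infinity>"
    then have "AE x in lborel. \<forall>n::nat. g x = 0 \<or> ennreal (real n) < g x"
      using lower by (subst AE_all_countable) auto
    then have "AE x in lborel. g x = 0"
      using finite_g
    proof eventually_elim
      case (elim x)
      show ?case
      proof (rule ccontr)
        assume "g x \<noteq> 0"
        obtain v where v: "g x = ennreal v" "0 \<le> v" using elim(2) by (cases "g x") auto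
        obtain n :: nat where "v \<le> real n" using real_arch_simple by blast
        then have "g x \<le> ennreal (real n)" using v by (simp add: ennreal_leI)
        then show False using elim(1) \<open>g x \<noteq> 0\<close> by (meson leD)
      qed
    qed
    then show False using nonzero by simp
  qed
  then obtain c where c: "energy UNIV = ennreal c" "0 \<le> c" by (cases "energy UNIV") auto
  have ge_c: "AE x in lborel. \<forall>q\<in>{q\<in>\<rat>. 0 \<le> q \<and> q < c}. g x = 0 \<or> ennreal q < g x"
    using lower c by (subst AE_ball_countable) (auto intro: countable_subset[OF _ countable_rat] simp: ennreal_less_iff)
  \<comment> \<open>On a bounded set \<open>B\<close> with \<open>p \<le> g \<le> q\<close> the two
    estimates give \<open>p\<^sup>2 * \<beta> \<le> c * q * \<beta>\<close>, where
    \<open>\<beta>\<close> is its Lebesgue measure; under the condition in \<open>J\<close> this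
    forces \<open>\<beta> = 0\<close>. Rational endpoints keep the exceptional sets countable in
    number.\<close>
  define J where "J = {(p, q). p \<in> \<rat> \<and> q \<in> \<rat> \<and> 0 < p \<and> 0 < q \<and> c * q < p\<^sup>2}"
  have "countable J"
    by (rule countable_subset[of _ "\<rat> \<times> \<rat>"]) (auto simp: J_def countable_rat)
  have band: "AE x in lborel. \<not> (ennreal p \<le> g x \<and> g x \<le> ennreal q \<and> \<bar>x\<bar> \<le> real n)"
    if pq: "(p, q) \<in> J" for p q n
  proof -
    define B where "B = {x. ennreal p \<le> g x \<and> g x \<le> ennreal q \<and> \<bar>x\<bar> \<le> real n}"
    have [measurable]: "B \<in> sets borel" unfolding B_def by measurable
    have p: "0 < p" "0 < q" "c * q < p\<^sup>2" using pq by (auto simp: J_def)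
    have "B \<subseteq> {- real n..real n}" by (auto simp: B_def abs_le_iff)
    then have "bounded B" using bounded_closed_interval bounded_subset by blast
    then have "emeasure lborel B < \<infinity>" by (rule emeasure_bounded_finite)
    then obtain \<beta> where \<beta>: "emeasure lborel B = ennreal \<beta>" "0 \<le> \<beta>" by (cases "emeasure lborel B") auto
    have "emeasure M B = (\<integral>\<^sup>+x. g x * indicator B x \<partial>lborel)"
      unfolding M by (intro emeasure_density) auto
    also have "\<dots> \<le> (\<integral>\<^sup>+x. ennreal q * indicator B x \<partial>lborel)"
      by (intro nn_integral_mono) (auto simp: B_def indicator_def)
    also have "\<dots> = ennreal q * ennreal \<beta>" by (simp add: nn_integral_cmult_indicator \<beta>)
    finally have "emeasure M B * ennreal c \<le> ennreal q * ennreal \<beta> * ennreal c"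
      by (intro mult_right_mono) auto
    moreover have "ennreal (p\<^sup>2) * emeasure lborel B \<le> energy B"
      using \<open>bounded B\<close> p by (intro energy_ge_if_density_ge[OF g _ M]) (auto simp: B_def)
    ultimately have "ennreal (p\<^sup>2) * ennreal \<beta> \<le> ennreal q * ennreal \<beta> * ennreal c"
      using energy_eq[of B] c \<beta> by simp
    then have "p\<^sup>2 * \<beta> \<le> q * \<beta> * c"
      using p c \<beta> by (simp add: ennreal_mult[symmetric])
    then have "\<beta> * (p\<^sup>2 - c * q) \<le> 0" by (simp add: algebra_simps)
    then have "\<beta> = 0" using p(3) \<beta>(2) by (simp add: mult_le_0_iff)
    then have "B \<in> null_sets lborel" using \<beta> by (auto simp: null_sets_def)
    then have "AE x in lborel. x \<notin> B" by (rule AE_not_in)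
    then show ?thesis by (simp add: B_def)
  qed
  have "AE x in lborel. \<forall>n::nat. \<not> (ennreal p \<le> g x \<and> g x \<le> ennreal q \<and> \<bar>x\<bar> \<le> real n)"
    if "(p, q) \<in> J" for p q
    using band[OF that] by (subst AE_all_countable) auto
  then have "AE x in lborel. \<forall>(p, q)\<in>J. \<forall>n::nat. \<not> (ennreal p \<le> g x \<and> g x \<le> ennreal q \<and> \<bar>x\<bar> \<le> real n)"
    using \<open>countable J\<close> by (subst AE_ball_countable) auto
  then have const: "AE x in lborel. g x = 0 \<or> g x = ennreal c"
    using ge_c finite_g
  proof eventually_elim
    case (elim x)
    obtain v where v: "g x = ennreal v" "0 \<le> v" using elim(3) by (cases "g x") auto
    have "v \<le> c"
    proof (rule ccontr)
      assume "\<not> v \<le> c"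
      then have vc: "c < v" "0 < v" using c(2) by auto
      \<comment> \<open>Chosen so that \<open>\<eta> * (2 * v + c)\<close> is half of
        \<open>v * (v - c)\<close>: then \<open>(v - \<eta>)\<^sup>2\<close> still exceeds
        \<open>c * (v + \<eta>)\<close>, and every rational band within \<open>\<eta>\<close> of
        \<open>v\<close> belongs to \<open>J\<close>.\<close>
      define \<eta> where "\<eta> = v * (v - c) / (2 * (2 * v + c))"
      have \<eta>: "0 < \<eta>" unfolding \<eta>_def using vc c(2) by (intro divide_pos_pos mult_pos_pos) auto
      have \<eta>_eq: "\<eta> * (2 * (2 * v + c)) = v * (v - c)" unfolding \<eta>_def using vc c(2) by simp
      have "\<eta> * (2 * (2 * v + c)) \<le> v * (2 * (2 * v + c)) / 2"
        unfolding \<eta>_eq using vc c(2) by (simp add: algebra_simps)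
      then have "\<eta> * (2 * (2 * v + c)) \<le> (v / 2) * (2 * (2 * v + c))" by simp
      then have "\<eta> \<le> v / 2" using vc c(2) by (subst (asm) mult_le_cancel_right) auto
      then have "\<eta> < v" using vc by simp
      obtain p where p: "p \<in> \<rat>" "v - \<eta> < p" "p < v" using Rats_dense_in_real[of "v - \<eta>" v] \<eta> by auto
      obtain q where q: "q \<in> \<rat>" "v < q" "q < v + \<eta>" using Rats_dense_in_real[of v "v + \<eta>"] \<eta> by auto
      have "c * q \<le> c * (v + \<eta>)" using q c(2) by (intro mult_left_mono) auto
      also have "c * (v + \<eta>) < (v - \<eta>)\<^sup>2"
      proof -
        have "(v - \<eta>)\<^sup>2 - c * (v + \<eta>) = v * (v - c) - \<eta> * (2 * v + c) + \<eta>\<^sup>2"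
          by (simp add: power2_eq_square algebra_simps)
        also have "\<dots> = \<eta> * (2 * v + c) + \<eta>\<^sup>2" unfolding \<eta>_eq[symmetric] by (simp add: algebra_simps)
        also have "\<dots> > 0"
        proof (rule add_pos_pos)
          have "0 < 2 * v + c" using vc c(2) by linarith
          then show "0 < \<eta> * (2 * v + c)" using \<eta> by simp
        qed (use \<eta> in simp)
        finally show ?thesis by simp
      qed
      also have "(v - \<eta>)\<^sup>2 \<le> p\<^sup>2" using p \<open>\<eta> < v\<close> by (intro power_mono) auto
      finally have "(p, q) \<in> J" using p q vc \<open>\<eta> < v\<close> by (auto simp: J_def)
      moreover obtain n :: nat where "\<bar>x\<bar> \<le> real n" using real_arch_simple by blast
      ultimately show False using elim(1) v p(3) q(2) by (fastforce intro: ennreal_leI)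
    qed
    moreover have "c \<le> v" if "g x \<noteq> 0"
    proof (rule ccontr)
      assume "\<not> c \<le> v"
      then obtain q where "q \<in> \<rat>" "v < q" "q < c" using Rats_dense_in_real[of v c] by auto
      then have "ennreal q < ennreal v" using elim(2) that v by auto
      then show False using \<open>v < q\<close> v(2) by (simp add: ennreal_less_iff)
    qed
    ultimately show ?case using v by (cases "g x = 0") auto
  qed
  moreover have "c \<noteq> 0" using const nonzero by auto
  ultimately show ?thesis using c(2) by (intro exI[of _ c]) auto
qed

end

section \<open>The attractor and the weights\<close>

lemma strict_mono_of_Suc:
  fixes b :: "nat \<Rightarrow> real"
  assumes "\<forall>i\<in>{1..<N}. b i < b (Suc i)" "1 \<le> i" "i < j" "j \<le> N"
  shows "b i < b j"
  using assms(3,4)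
proof (induction j)
  case (Suc j)
  have "b j < b (Suc j)" using assms(1,2) Suc.prems by auto
  then show ?case using Suc by (cases "i = j") auto
qed simp

text \<open>The least element \<open>m\<close> is an image under some map, so
  \<open>lam * m \<le> m\<close>, while the first map sends it to \<open>lam * m\<close>, which
  cannot be smaller. Hence \<open>m = 0\<close>; the greatest element is treated likewise with the
  last map.\<close>

lemma attractor_bounds:
  assumes lam: "0 < lam" "lam < 1"
    and b: "b 1 = 0" "b N = 1 - lam" "\<forall>i\<in>{1..<N}. b i < b (Suc i)" and N: "1 \<le> N"
    and X: "is_attractor lam b N X"
  shows "X \<subseteq> {0..1}" "0 \<in> X" "1 \<in> X"
proof -
  have X': "X \<noteq> {}" "compact X" "X = (\<Union>i\<in>{1..N}. tau lam (b i) ` X)"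
    using X unfolding is_attractor_def by blast+
  have range_b: "0 \<le> b i" "b i \<le> 1 - lam" if "i \<in> {1..N}" for i
    using strict_mono_of_Suc[OF b(3), of 1 i] strict_mono_of_Suc[OF b(3), of i N] that b(1,2)
    by (cases "i = 1"; cases "i = N"; force)+
  have tau_in: "tau lam (b i) x \<in> X" if "i \<in> {1..N}" "x \<in> X" for i x
    using that X'(3) by blast
  obtain m where m: "m \<in> X" "\<And>x. x \<in> X \<Longrightarrow> m \<le> x"
    using compact_attains_inf[OF X'(2,1)] by blast
  obtain m' where m': "m' \<in> X" "\<And>x. x \<in> X \<Longrightarrow> x \<le> m'"
    using compact_attains_sup[OF X'(2,1)] by blast
  obtain i x where ix: "i \<in> {1..N}" "x \<in> X" "m = lam * x + b i"
  proof -
    have "m \<in> (\<Union>i\<in>{1..N}. tau lam (b i) ` X)" using m(1) by (simp only: X'(3)[symmetric])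
    then show ?thesis using that by (auto simp: tau_def)
  qed
  have "lam * m \<le> lam * x" using m(2)[OF ix(2)] lam by simp
  then have "lam * m \<le> m" using ix range_b[OF ix(1)] by linarith
  moreover have "m \<le> lam * m" using m(2)[OF tau_in[of 1 m]] m(1) N b(1) by (simp add: tau_def)
  ultimately have "(1 - lam) * m = 0" by (simp add: algebra_simps)
  then have m0: "m = 0" using lam by simp
  obtain j y where jy: "j \<in> {1..N}" "y \<in> X" "m' = lam * y + b j"
  proof -
    have "m' \<in> (\<Union>i\<in>{1..N}. tau lam (b i) ` X)" using m'(1) by (simp only: X'(3)[symmetric])
    then show ?thesis using that by (auto simp: tau_def)
  qed
  have "lam * y \<le> lam * m'" using m'(2)[OF jy(2)] lam by simp
  then have "m' \<le> lam * m' + (1 - lam)" using jy range_b[OF jy(1)] by linarith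
  moreover have "lam * m' + (1 - lam) \<le> m'" using m'(2)[OF tau_in[of N m']] m'(1) N b(2) by (simp add: tau_def)
  ultimately have "(1 - lam) * (m' - 1) = 0" by (simp add: algebra_simps)
  then have m1: "m' = 1" using lam by simp
  show "X \<subseteq> {0..1}" "0 \<in> X" "1 \<in> X" using m m' m0 m1 by auto
qed

text \<open>Both sides of the self-similarity have densities; the change of variables in the
  \<open>i\<close>-th piece contributes the factor \<open>1 / lam\<close>, and densities are unique
  almost everywhere.\<close>

lemma self_similar_indicator_density:
  fixes c :: real
  assumes lam: "0 < lam" and p: "\<forall>i\<in>{1..N}. 0 < p i" and S[measurable]: "S \<in> sets borel"
    and mu: "is_self_similar_measure lam b p N \<mu>"
    and dens: "\<mu> = density lborel (\<lambda>x. ennreal c * indicator S x)" and c: "0 < c"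
  shows "AE y in lborel. (indicator S y :: real) = (\<Sum>i\<in>{1..N}. p i / lam * indicator S ((y - b i) / lam))"
proof -
  define f where "f y = (\<Sum>i\<in>{1..N}. ennreal (p i / lam) * (ennreal c * indicator S ((y - b i) / lam)))" for y
  have [measurable]: "f \<in> borel_measurable borel" unfolding f_def by measurable
  have "density lborel (\<lambda>x. ennreal c * indicator S x) = density lborel f"
  proof (rule measure_eqI)
    fix A assume "A \<in> sets (density lborel (\<lambda>x. ennreal c * indicator S x))"
    then have A[measurable]: "A \<in> sets borel" by simp
    have "emeasure \<mu> (tau lam (b i) -` A) = ennreal (1 / lam) * (\<integral>\<^sup>+y. ennreal c * indicator S ((y - b i) / lam) * indicator A y \<partial>lborel)" for i
    proof -
      have [measurable]: "tau lam (b i) \<in> borel_measurable borel" unfolding tau_def by measurable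
      have [measurable]: "tau lam (b i) -` A \<in> sets borel"
        using measurable_sets[of "tau lam (b i)" borel borel A] by simp
      have "emeasure \<mu> (tau lam (b i) -` A) = (\<integral>\<^sup>+x. ennreal c * indicator S x * indicator (tau lam (b i) -` A) x \<partial>lborel)"
        unfolding dens by (subst emeasure_density) auto
      also have "\<dots> = (\<integral>\<^sup>+x. ennreal c * indicator S x * indicator A (b i + lam * x) \<partial>lborel)"
        by (intro nn_integral_cong) (auto simp: tau_def indicator_def add.commute)
      also have "\<dots> = ennreal (1 / lam) * (\<integral>\<^sup>+y. ennreal c * indicator S ((y - b i) / lam) * indicator A y \<partial>lborel)"
        using lam by (subst nn_integral_real_affine[where c = "1 / lam" and t = "- b i / lam"])
          (auto simp: field_simps)
      finally show ?thesis .
    qed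
    moreover have "emeasure \<mu> A = (\<Sum>i\<in>{1..N}. ennreal (p i) * emeasure \<mu> (tau lam (b i) -` A))"
      using mu A by (simp add: is_self_similar_measure_def)
    ultimately have "emeasure \<mu> A = (\<Sum>i\<in>{1..N}. ennreal (p i) *
        (ennreal (1 / lam) * (\<integral>\<^sup>+y. ennreal c * indicator S ((y - b i) / lam) * indicator A y \<partial>lborel)))"
      by simp
    also have "\<dots> = (\<Sum>i\<in>{1..N}. (\<integral>\<^sup>+y. ennreal (p i / lam) * (ennreal c * indicator S ((y - b i) / lam)) * indicator A y \<partial>lborel))"
    proof (rule sum.cong[OF refl])
      fix i assume "i \<in> {1..N}"
      then have "ennreal (p i) * ennreal (1 / lam) = ennreal (p i / lam)"
        using p lam by (simp add: ennreal_mult[symmetric] less_imp_le)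
      then show "ennreal (p i) * (ennreal (1 / lam) * (\<integral>\<^sup>+y. ennreal c * indicator S ((y - b i) / lam) * indicator A y \<partial>lborel))
          = (\<integral>\<^sup>+y. ennreal (p i / lam) * (ennreal c * indicator S ((y - b i) / lam)) * indicator A y \<partial>lborel)"
        by (simp only: mult.assoc[symmetric], subst nn_integral_cmult[symmetric]) (auto simp: mult.assoc)
    qed
    also have "\<dots> = (\<integral>\<^sup>+y. f y * indicator A y \<partial>lborel)"
      unfolding f_def by (subst nn_integral_sum[symmetric]) (auto simp: sum_distrib_right)
    also have "\<dots> = emeasure (density lborel f) A" by (subst emeasure_density) auto
    finally show "emeasure (density lborel (\<lambda>x. ennreal c * indicator S x)) A = emeasure (density lborel f) A"
      by (simp only: dens)
  qed simp
  then have "AE y in lborel. ennreal c * indicator S y = f y"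
    by (subst (asm) sigma_finite_measure.density_unique_iff[OF sigma_finite_lborel]) auto
  then show ?thesis
  proof eventually_elim
    case (elim y)
    have "f y = (\<Sum>i\<in>{1..N}. ennreal (p i / lam * (c * indicator S ((y - b i) / lam))))"
      unfolding f_def using c p lam by (intro sum.cong refl) (auto simp: indicator_def ennreal_mult[symmetric] less_imp_le)
    also have "\<dots> = ennreal (\<Sum>i\<in>{1..N}. p i / lam * (c * indicator S ((y - b i) / lam)))"
      using c p lam by (intro sum_ennreal) (auto simp: less_imp_le)
    finally have "ennreal (c * indicator S y) = ennreal (\<Sum>i\<in>{1..N}. p i / lam * (c * indicator S ((y - b i) / lam)))"
      using elim c by (simp add: ennreal_mult ennreal_indicator)
    then have "c * indicator S y = (\<Sum>i\<in>{1..N}. p i / lam * (c * indicator S ((y - b i) / lam)))"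
      using c p lam by (subst (asm) ennreal_inj) (auto intro!: sum_nonneg simp: less_imp_le)
    also have "\<dots> = c * (\<Sum>i\<in>{1..N}. p i / lam * indicator S ((y - b i) / lam))"
      by (simp add: sum_distrib_left mult_ac)
    finally show ?case using c by simp
  qed
qed

text \<open>The first map is multiplication by \<open>lam\<close> and has positive weight, so a null
  interval at 0 may be stretched by \<open>1 / lam\<close> and stays null; iterating would cover the
  unit interval.\<close>

lemma self_similar_measure_near_zero:
  assumes lam: "0 < lam" "lam < 1" and b1: "b 1 = 0" and N: "1 \<le> N" and p: "\<forall>i\<in>{1..N}. 0 < p i"
    and mu: "is_self_similar_measure lam b p N \<mu>" and supp: "emeasure \<mu> {0..1} \<noteq> 0" and \<delta>: "0 < \<delta>"
  shows "emeasure \<mu> {0..<\<delta>} \<noteq> 0"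
proof
  assume zero: "emeasure \<mu> {0..<\<delta>} = 0"
  have step: "emeasure \<mu> {0..<\<epsilon> / lam} = 0" if "emeasure \<mu> {0..<\<epsilon>} = 0" for \<epsilon>
  proof -
    have "(\<Sum>i\<in>{1..N}. ennreal (p i) * emeasure \<mu> (tau lam (b i) -` {0..<\<epsilon>})) = 0"
      using mu that by (simp add: is_self_similar_measure_def)
    then have "ennreal (p 1) * emeasure \<mu> (tau lam (b 1) -` {0..<\<epsilon>}) = 0"
      using N by (subst (asm) sum_eq_0_iff) auto
    moreover have "tau lam (b 1) -` {0..<\<epsilon>} = {0..<\<epsilon> / lam}"
      using lam b1 by (auto simp: tau_def field_simps zero_le_mult_iff)
    moreover have "0 < p 1" using p N by auto
    ultimately show ?thesis by simp
  qed
  have "emeasure \<mu> {0..<\<delta> / lam ^ n} = 0" for n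
  proof (induction n)
    case (Suc n)
    then show ?case using step[of "\<delta> / lam ^ n"] by (simp add: field_simps)
  qed (simp add: zero)
  moreover obtain n where "lam ^ n < \<delta>" using real_arch_pow_inv[OF \<delta> lam(2)] by blast
  then have "1 < \<delta> / lam ^ n" using lam by (simp add: field_simps)
  then have "{0..1} \<subseteq> {0..<\<delta> / lam ^ n}" by auto
  moreover have "sets \<mu> = sets borel" using mu by (simp add: is_self_similar_measure_def)
  ultimately have "emeasure \<mu> {0..1} \<le> 0"
    by (metis atLeastLessThan_borel emeasure_mono)
  then show False using supp by simp
qed

text \<open>Evaluate the indicator identity at \<open>b k + lam * x\<close> for \<open>x\<close> in
  \<open>S\<close> close to 0. Pieces after \<open>k\<close> vanish there and earlier ones have
  weight 1 by induction, so a value in \<open>{0, 1}\<close> equals a natural number plus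
  \<open>p k / lam > 0\<close>.\<close>

lemma self_similar_weights:
  fixes c :: real
  assumes lam: "0 < lam" "lam < 1"
    and b: "b 1 = 0" "\<forall>i\<in>{1..<N}. b i < b (Suc i)"
    and p: "\<forall>i\<in>{1..N}. 0 < p i"
    and mu: "is_self_similar_measure lam b p N \<mu>" and supp: "AE x in \<mu>. x \<in> {0..1}"
    and S[measurable]: "S \<in> sets borel" and c: "0 < c"
    and dens: "\<mu> = density lborel (\<lambda>x. ennreal c * indicator S x)"
    and k: "k \<in> {1..N}"
  shows "p k = lam"
  using k
proof (induction k rule: less_induct)
  case (less k)
  have prob: "prob_space \<mu>" and sets_mu: "sets \<mu> = sets borel"
    using mu by (auto simp: is_self_similar_measure_def)
  have S01: "AE x in lborel. x \<in> S \<longrightarrow> x \<in> {0..1}"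
    using supp c unfolding dens by (subst (asm) AE_density) (auto simp: indicator_def elim!: eventually_mono)
  have "emeasure \<mu> {0..1} \<noteq> 0"
    using prob_space.emeasure_eq_1_AE[OF prob _ supp] sets_mu by simp
  \<comment> \<open>For \<open>x < \<delta>\<close> the point \<open>b k + lam * x\<close> lies left
    of \<open>b (Suc k)\<close>. When \<open>k = N\<close> any positive number would do.\<close>
  define \<delta> where "\<delta> = (if k < N then (b (Suc k) - b k) / lam else 1)"
  have \<delta>: "0 < \<delta>" using b(2) less.prems lam by (auto simp: \<delta>_def)
  have pos: "emeasure \<mu> {0..<\<delta>} \<noteq> 0"
    using less.prems \<open>emeasure \<mu> {0..1} \<noteq> 0\<close>
    by (intro self_similar_measure_near_zero[OF lam b(1) _ p mu _ \<delta>]) auto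
  have not_AE: "\<not> (AE x in lborel. \<not> (x \<in> S \<and> x \<in> {0..<\<delta>}))"
  proof
    assume "AE x in lborel. \<not> (x \<in> S \<and> x \<in> {0..<\<delta>})"
    then have "(\<integral>\<^sup>+x. ennreal c * indicator S x * indicator {0..<\<delta>} x \<partial>lborel) = 0"
      by (subst nn_integral_0_iff_AE) (auto elim!: eventually_mono simp: indicator_def)
    then show False using pos unfolding dens by (subst (asm) emeasure_density) auto
  qed
  let ?E = "\<lambda>y. (indicator S y :: real) = (\<Sum>i\<in>{1..N}. p i / lam * indicator S ((y - b i) / lam))"
  let ?F = "\<lambda>x. x \<in> S \<longrightarrow> x \<in> {0..1}"
  have "AE y in lborel. ?E y" by (rule self_similar_indicator_density[OF lam(1) p S mu dens c])
  then have AE1: "AE x in lborel. ?E (b k + lam * x)"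
    using lam by (intro AE_borel_affine) auto
  have "AE x in lborel. ?F ((b k - b i) / lam + 1 * x)" for i
    using S01 by (intro AE_borel_affine) auto
  then have AE2: "AE x in lborel. \<forall>i. ?F ((b k - b i) / lam + 1 * x)"
    by (subst AE_all_countable) blast
  \<comment> \<open>\<open>S\<close> meets the interval from 0 to \<open>\<delta>\<close> in a set
    that is not null, so one point there avoids all exceptional sets at once.\<close>
  have "\<exists>x. x \<in> S \<and> x \<in> {0..<\<delta>} \<and> ?E (b k + lam * x) \<and> (\<forall>i. ?F ((b k - b i) / lam + 1 * x))"
  proof (rule ccontr)
    assume neg: "\<nexists>x. x \<in> S \<and> x \<in> {0..<\<delta>} \<and> ?E (b k + lam * x) \<and> (\<forall>i. ?F ((b k - b i) / lam + 1 * x))"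
    have "AE x in lborel. \<not> (x \<in> S \<and> x \<in> {0..<\<delta>})"
      using AE1 AE2 by eventually_elim (use neg in blast)
    then show False using not_AE by blast
  qed
  then obtain x where x: "x \<in> S" "0 \<le> x" "x < \<delta>" "?E (b k + lam * x)" "\<And>i. ?F ((b k - b i) / lam + x)" by auto
  define e where "e i = (indicator S ((b k + lam * x - b i) / lam) :: real)" for i
  have arg: "(b k + lam * x - b i) / lam = (b k - b i) / lam + x" for i
    using lam by (simp add: field_simps)
  have "e i = 0" if i: "i \<in> {k<..N}" for i
  proof -
    have "k < N" using i by auto
    then have "b (Suc k) \<le> b i"
      using i strict_mono_of_Suc[OF b(2), of "Suc k" i] by (cases "i = Suc k") auto
    moreover have "lam * x < b (Suc k) - b k"
      using x(3) \<open>k < N\<close> lam by (simp add: \<delta>_def field_simps)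
    ultimately have "(b k + lam * x - b i) / lam < 0" using lam by (simp add: field_simps)
    then show ?thesis using x(5)[of i] unfolding e_def arg by (auto simp: indicator_def)
  qed
  then have "(\<Sum>i\<in>{k<..N}. p i / lam * e i) = 0" by simp
  moreover have split: "{1..N} = ({1..<k} \<union> {k}) \<union> {k<..N}" using less.prems by auto
  have "(\<Sum>i\<in>{1..N}. p i / lam * e i)
      = (\<Sum>i\<in>{1..<k}. p i / lam * e i) + p k / lam * e k + (\<Sum>i\<in>{k<..N}. p i / lam * e i)"
    unfolding split by (subst sum.union_disjoint, auto simp del: Un_insert_right, subst sum.union_disjoint, auto)
  moreover have "(\<Sum>i\<in>{1..<k}. p i / lam * e i) = (\<Sum>i\<in>{1..<k}. e i)"
    using less lam by (intro sum.cong refl) auto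
  moreover have "e k = 1" using x(1) lam by (simp add: e_def)
  ultimately have eq: "indicator S (b k + lam * x) = (\<Sum>i\<in>{1..<k}. e i) + p k / lam"
    using x(4) by (simp add: e_def)
  have "(\<Sum>i\<in>{1..<k}. e i) = real (card {i\<in>{1..<k}. (b k + lam * x - b i) / lam \<in> S})"
    by (simp add: e_def indicator_def sum.If_cases Int_def)
  then obtain m :: nat where m: "(\<Sum>i\<in>{1..<k}. e i) = real m" by blast
  have pos: "0 < p k / lam" using p less.prems lam by simp
  have "real m + p k / lam \<le> 1"
  proof -
    have "indicat_real S (b k + lam * x) \<le> 1" by simp
    then show ?thesis using eq m by linarith
  qed
  then have "m = 0" using pos by simp
  then have "p k / lam = indicator S (b k + lam * x)" using eq m by simp
  then have "p k / lam = 1" using pos by (cases "b k + lam * x \<in> S") auto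
  then show ?case using lam by simp
qed

theorem theorem4p2:
  fixes lam :: real and N :: nat and b p :: "nat \<Rightarrow> real"
    and X :: "real set" and \<mu> :: "real measure"
  assumes lam: "0 < lam" "lam < 1"
    and b1: "b 1 = 0" and bN: "b N = 1 - lam"
    and b_mono: "\<forall>i\<in>{1..<N}. b i < b (Suc i)"
    and p_pos: "\<forall>i\<in>{1..N}. p i > 0"
    and p_sum: "(\<Sum>i\<in>{1..N}. p i) = 1"
    and X: "is_attractor lam b N X"
    and mu: "is_self_similar_measure lam b p N \<mu>"
    and ac: "absolutely_continuous (density lborel (indicator X)) \<mu>"
    and frame: "\<exists>\<nu>. tight_frame_measure \<mu> \<nu>"
  shows "(\<forall>i\<in>{1..N}. p i = lam)
    \<and> lam = 1 / real N
    \<and> (\<exists>\<alpha>>0. \<exists>D::int set. of_int ` D = (\<lambda>i. \<alpha> * b i) ` {1..N}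
          \<and> (\<exists>E::int set. direct_sum_Z D E))"
proof -
  have "N \<noteq> 0" using p_sum by (intro notI) simp
  moreover have "N \<noteq> 1" using b1 bN lam by auto
  ultimately have N: "2 \<le> N" by simp
  have N1: "1 \<le> N" using N by simp
  note X01 = attractor_bounds[OF lam b1 bN b_mono N1 X]
  have X': "compact X" "X = (\<Union>i\<in>{1..N}. tau lam (b i) ` X)"
    using X unfolding is_attractor_def by blast+
  have X_borel[measurable]: "X \<in> sets borel" using X'(1) by (intro borel_compact)
  have prob: "prob_space \<mu>" and sets_mu: "sets \<mu> = sets borel"
    using mu by (auto simp: is_self_similar_measure_def)
  interpret real_distribution \<mu> using prob sets_mu by (intro real_distribution.intro real_distribution_axioms.intro)
  \<comment> \<open>Absolute continuity relative to Lebesgue measure on \<open>X\<close> is used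
    twice: it supplies the density \<open>g\<close>, and it shows that \<open>\<mu>\<close> is
    carried by \<open>X\<close>.\<close>
  have null: "A \<in> null_sets \<mu>" if "A \<in> sets borel" "AE x in lborel. x \<in> A \<longrightarrow> x \<notin> X" for A
  proof -
    have "A \<in> null_sets (density lborel (indicator X))"
      using that by (subst null_sets_density_iff) (auto simp: indicator_def elim!: eventually_mono)
    then show ?thesis using ac unfolding absolutely_continuous_def by blast
  qed
  have "absolutely_continuous lborel \<mu>"
    unfolding absolutely_continuous_def
  proof
    fix A :: "real set" assume A: "A \<in> null_sets lborel"
    have "AE x in lborel. x \<notin> A" using A by (rule AE_not_in)
    then show "A \<in> null_sets \<mu>" using A by (intro null) (auto elim!: eventually_mono)
  qed
  then obtain g where g: "g \<in> borel_measurable borel" "density lborel g = \<mu>"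
    using sigma_finite_measure.Radon_Nikodym[OF sigma_finite_lborel, of \<mu>] sets_mu by auto
  note [measurable] = g(1)
  obtain c where c: "0 < c" "AE x in lborel. g x = 0 \<or> g x = ennreal c"
    using tight_frame_density_const[OF g(1) g(2)[symmetric]] frame by blast
  define S where "S = {x. g x \<noteq> 0}"
  have S[measurable]: "S \<in> sets borel" unfolding S_def by measurable
  have dens: "\<mu> = density lborel (\<lambda>x. ennreal c * indicator S x)"
    unfolding g(2)[symmetric] using c(2)
    by (intro density_cong) (auto elim!: eventually_mono simp: S_def indicator_def)
  have "- X \<in> null_sets \<mu>" by (rule null) auto
  then have AE_X: "AE x in \<mu>. x \<in> X" using AE_not_in[of "- X" \<mu>] by simp
  then have supp: "AE x in \<mu>. x \<in> {0..1}" using X01(1) by (auto elim!: eventually_mono)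
  have p_eq: "p i = lam" if "i \<in> {1..N}" for i
    by (rule self_similar_weights[OF lam b1 b_mono p_pos mu supp S c(1) dens that])
  then have "real N * lam = 1" using p_sum by simp
  then have lam_eq: "lam = 1 / real N" using N by (simp add: field_simps)
  define D where "D = (\<lambda>i. real N * b i) ` {1..N}"
  have "inj_on (\<lambda>i. real N * b i) {1..N}"
  proof (rule linorder_inj_onI')
    fix i j assume "i \<in> {1..N}" "j \<in> {1..N}" "i < j"
    then show "real N * b i \<noteq> real N * b j" using strict_mono_of_Suc[OF b_mono, of i j] N by auto
  qed
  then have card_D: "card D = N" unfolding D_def by (simp add: card_image)
  \<comment> \<open>If \<open>X\<close> were Lebesgue null, \<open>\<mu>\<close> would vanish on the
    set that carries it.\<close>
  have "measure lebesgue X \<noteq> 0"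
  proof
    assume "measure lebesgue X = 0"
    then have "negligible X" using lmeasurable_compact[OF X'(1)] by (simp add: negligible_iff_measure)
    then have "emeasure lborel X = 0"
      using X_borel by (simp add: negligible_iff_emeasure0)
    then have "X \<in> null_sets lborel" by (auto simp: null_sets_def)
    then have "AE x in lborel. x \<notin> X" by (rule AE_not_in)
    then have "X \<in> null_sets \<mu>" by (intro null) (auto elim!: eventually_mono)
    then have "AE x in \<mu>. x \<notin> X" by (rule AE_not_in)
    then have "AE x in \<mu>. False" using AE_X by eventually_elim auto
    then show False using prob_space by (simp add: AE_False)
  qed
  then have X_pos: "0 < measure lebesgue X" by (simp add: zero_less_measure_iff)
  interpret self_affine_tile N D X
  proof
    show "0 \<in> D" unfolding D_def using b1 N by (intro image_eqI[of _ _ 1]) auto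
    \<comment> \<open>Multiplying the attractor equation by \<open>N = 1 / lam\<close> turns the
      contractions into translations by the digits \<open>N * b i\<close>.\<close>
    have "real N * tau lam (b i) x = real N * b i + x" for i x
      using N by (simp add: tau_def lam_eq field_simps)
    then have "(*) (real N) ` (\<Union>i\<in>{1..N}. tau lam (b i) ` X) = (\<Union>d\<in>D. (+) d ` X)"
      unfolding D_def image_UN image_image by simp
    then show "(*) (real N) ` X = (\<Union>d\<in>D. (+) d ` X)" using X'(2) by simp
  qed (use N card_D X'(1) X01 X_pos in auto)
  obtain \<sigma> D' E where \<sigma>: "0 < \<sigma>" "of_int ` D' = (*) \<sigma> ` D" "direct_sum_Z D' E"
    using digits_tile_integers by blast
  have "of_int ` D' = (\<lambda>i. (\<sigma> * real N) * b i) ` {1..N}"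
    unfolding \<sigma>(2) D_def image_image by (simp add: mult.assoc)
  moreover have "0 < \<sigma> * real N" using \<sigma>(1) N by simp
  ultimately show ?thesis using p_eq lam_eq \<sigma>(3) by blast
qed

end
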